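(* Let $L\ge1$, let $\beta_1,\dots,\beta_L$ be distinct nonzero complex numbers not on $\mathbb T$, and let $\Phi_n,\bar\Phi_n,\Phi^*_n,\Xi_n,\Xi^*_n$, with leading coefficient $\widehat\kappa_n$ and $\widehat r_n=\Phi_n(0)/\widehat\kappa_n$, $\widehat{\bar r}_n=\bar\Phi_n(0)/\widehat\kappa_n$, be the bi-orthogonal system of the weight $\widehat w(z)=w(z)/\prod_{j=1}^L(z-\beta_j)$. Let $n\ge L$. For a sequence $a=(a_m)$ write $$v(a,z)=\big(z^{-m}a_m(z)\big)_{m=n-L,\dots,n},\qquad u(a,z)=\big(z^{-m}a_m(z)\big)_{m=n-L,\dots,n-1},\qquad v'(a,z)=\big(z^{-m-1}a_m(z)\big)_{m=n-L,\dots,n},$$ and let $\det(v_0;\dots;v_N)$ be the determinant with rows $v_0,\dots,v_N$. Then $$\Phi_n(z)=\frac{(-1)^L}{\widehat\kappa_n}\,\frac{\det\big((z^L\phi_{n-L}(z),z^{L-1}\phi_{n-L+1}(z),\dots,\phi_n(z));v(\xi,\beta_1);\dots;v(\xi,\beta_L)\big)}{\det\big((1/\kappa_{n-L},\dots,1/\kappa_n);v'(\xi,\beta_1);\dots;v'(\xi,\beta_L)\big)},$$ $$\Phi^*_n(z)=(-1)^L\frac{\widehat\kappa_n}{\kappa_n}\,\frac{\det\big((z^L\phi^*_{n-L}(z),\dots,\phi^*_n(z));v(\xi^*,\beta_1);\dots;v(\xi^*,\beta_L)\big)}{\det\big(u(\xi^*,\beta_1);\dots;u(\xi^*,\beta_L)\big)},$$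 $$\prod_{j=1}^L(z-\beta_j)\,\Xi_n(z)=C\,\frac{\det\big((z^L\xi_{n-L}(z),\dots,\xi_n(z));v(\xi,\beta_1);\dots;v(\xi,\beta_L)\big)}{\det\big(u(\xi,\beta_1);\dots;u(\xi,\beta_L)\big)}$$ for some constant $C$ independent of $z$, and $$\prod_{j=1}^L(z-\beta_j)\,\Xi^*_n(z)=(-1)^L\frac{\widehat\kappa_n}{\kappa_n}\,z^n\,\frac{\det\big(v(\xi^*,z);v(\xi^*,\beta_1);\dots;v(\xi^*,\beta_L)\big)}{\det\big(u(\xi^*,\beta_1);\dots;u(\xi^*,\beta_L)\big)}.$$ The leading and $r$-coefficients are given by $$\widehat\kappa_n^2=(-1)^L\frac{\det\big((\kappa_{n-L},\dots,\kappa_n);v(\xi,\beta_1);\dots;v(\xi,\beta_L)\big)}{\det\big((1/\kappa_{n-L},\dots,1/\kappa_n);v'(\xi,\beta_1);\dots;v'(\xi,\beta_L)\big)},$$ $$\widehat r_n=(-1)^L\phi_n(0)\frac{\det\big(u(\xi,\beta_1);\dots;u(\xi,\beta_L)\big)}{\det\big((\kappa_{n-L},\dots,\kappa_n);v(\xi,\beta_1);\dots;v(\xi,\beta_L)\big)},$$ $$\widehat{\bar r}_n=\frac{(-1)^L}{\kappa_n}\,\frac{\det\big((\bar\phi_{n-L}(0),\dots,\bar\phi_n(0));v(\xi^*,\beta_1);\dots;v(\xi^*,\beta_L)\big)}{\det\big(u(\xi^*,\beta_1);\dots;u(\xi^*,\beta_L)\big)}.$$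
   Context: $\mathbb T$ is the unit circle. For a complex-valued weight $w$ on $\mathbb T$ put $w_k=\int_{\mathbb T}\frac{d\zeta}{2\pi i\zeta}w(\zeta)\zeta^{-k}$ and $I_n[w]=\det[w_{j-k}]_{j,k=0,\dots,n-1}$, $I_0=1$. If $I_n[w]\ne0$ for all $n\ge0$, the bi-orthogonal system of $w$ is: polynomials $\phi_n,\bar\phi_n$ of degree $n$ with the same leading coefficient $\kappa_n$ satisfying $\int_{\mathbb T}\frac{d\zeta}{2\pi i\zeta}w(\zeta)\phi_m(\zeta)\bar\phi_n(\bar\zeta)=\delta_{m,n}$ with $\bar\zeta=1/\zeta$ ($\bar\phi_n$ is a separate polynomial, not in general the complex conjugate of $\phi_n$; $\kappa_n^2=I_n/I_{n+1}$, with a choice of square root $\kappa_n$ fixed); the reciprocal polynomial $\phi^*_n(z)=z^n\bar\phi_n(1/z)$; and the associated functions, for $z\notin\mathbb T$ and $n>0$, $\xi_n(z)=\int_{\mathbb T}\frac{d\zeta}{2\pi i\zeta}\frac{\zeta+z}{\zeta-z}w(\zeta)\phi_n(\zeta)$, $\ \xi^*_n(z)=-z^n\int_{\mathbb T}\frac{d\zeta}{2\pi i\zeta}\frac{\zeta+z}{\zeta-z}w(\zeta)\bar\phi_n(\bar\zeta)=\frac1{\kappa_n}-\int_{\mathbb T}\frac{d\zeta}{2\pi i\zeta}\frac{\zeta+z}{\zeta-z}w(\zeta)\phi^*_n(\zeta)$, and $\xi_0(z)=\kappa_0[w_0+F(z)]$, $\xi^*_0(z)=\kappa_0[w_0-F(z)]$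 with $F(z)=\int_{\mathbb T}\frac{d\zeta}{2\pi i\zeta}\frac{\zeta+z}{\zeta-z}w(\zeta)$. Set $r_n=\phi_n(0)/\kappa_n$, $\bar r_n=\bar\phi_n(0)/\kappa_n$. The same definitions and normalisation applied to a modified weight $\widehat w$ give $\Phi_n,\bar\Phi_n,\Phi^*_n,\Xi_n,\Xi^*_n$, leading coefficient $\widehat\kappa_n$, and $\widehat r_n,\widehat{\bar r}_n$. Standing generic assumptions: both the original and the modified bi-orthogonal systems exist, and $r_n\bar r_n\ne0,1$, $\widehat r_n\widehat{\bar r}_n\ne0,1$ for all $n\ge1$. *)

theory Defs
  imports
    "HOL-Complex_Analysis.Contour_Integration"
    "HOL-Computational_Algebra.Polynomial"
    "Jordan_Normal_Form.Determinant"
begin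

text \<open>A function \<open>w\<close> is used only through its values on the unit circle; all integrals are against
  the normalised measure \<open>d\<zeta> / (2 \<pi> i \<zeta>)\<close>, with the circle traversed counterclockwise.\<close>

definition circ_int :: "(complex \<Rightarrow> complex) \<Rightarrow> complex" where
  "circ_int f = contour_integral (circlepath 0 1) (\<lambda>\<zeta>. f \<zeta> / (2 * of_real pi * \<i> * \<zeta>))"

text \<open>A complex weight is taken to be Lebesgue integrable on the circle, so that all the integrals
  below are proper ones.\<close>

definition circle_weight :: "(complex \<Rightarrow> complex) \<Rightarrow> bool" where
  "circle_weight w \<longleftrightarrow> (\<lambda>t. w (circlepath 0 1 t)) absolutely_integrable_on {0..1}"

definition fourier_coeff :: "(complex \<Rightarrow> complex) \<Rightarrow> int \<Rightarrow> complex" where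
  "fourier_coeff w k = circ_int (\<lambda>\<zeta>. w \<zeta> * \<zeta> powi (- k))"

definition toeplitz_det :: "(complex \<Rightarrow> complex) \<Rightarrow> nat \<Rightarrow> complex" where
  "toeplitz_det w n =
     Determinant.det (Matrix.mat n n (\<lambda>(j, k). fourier_coeff w (int j - int k)))"

text \<open>The sequences \<open>\<phi>\<close> and \<open>\<psi>\<close> are \<open>\<phi>\<^sub>n\<close> and its companion (barred) polynomial, which
  is not in general the complex conjugate of \<open>\<phi>\<^sub>n\<close>. The normalisation determines the pair
  \<open>(\<phi>\<^sub>n, \<psi>\<^sub>n)\<close> up to a common sign; giving the pair fixes the square root
  \<open>\<kappa>\<^sub>n = lead_coeff (\<phi> n)\<close> of the ratio of Toeplitz determinants.\<close>

definition biorthogonal_system ::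
    "(complex \<Rightarrow> complex) \<Rightarrow> (nat \<Rightarrow> complex poly) \<Rightarrow> (nat \<Rightarrow> complex poly) \<Rightarrow> bool" where
  "biorthogonal_system w \<phi> \<psi> \<longleftrightarrow>
     (\<forall>n. toeplitz_det w n \<noteq> 0) \<and>
     (\<forall>n. degree (\<phi> n) = n \<and> degree (\<psi> n) = n \<and> lead_coeff (\<phi> n) = lead_coeff (\<psi> n)) \<and>
     (\<forall>m n. circ_int (\<lambda>\<zeta>. w \<zeta> * poly (\<phi> m) \<zeta> * poly (\<psi> n) (1 / \<zeta>)) = (if m = n then 1 else 0))"

text \<open>The reciprocal polynomial \<open>z\<^sup>n \<psi>\<^sub>n(1/z)\<close>: since \<open>degree (\<psi> n) = n\<close>, this is
  the reflected polynomial, which also has the correct value at \<open>z = 0\<close>.\<close>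

definition reciprocal :: "(nat \<Rightarrow> complex poly) \<Rightarrow> nat \<Rightarrow> complex poly" where
  "reciprocal \<psi> n = reflect_poly (\<psi> n)"

definition caratheodory_fun :: "(complex \<Rightarrow> complex) \<Rightarrow> complex \<Rightarrow> complex" where
  "caratheodory_fun w z = circ_int (\<lambda>\<zeta>. (\<zeta> + z) / (\<zeta> - z) * w \<zeta>)"

definition assoc_fun ::
    "(complex \<Rightarrow> complex) \<Rightarrow> (nat \<Rightarrow> complex poly) \<Rightarrow> nat \<Rightarrow> complex \<Rightarrow> complex" where
  "assoc_fun w \<phi> n z =
     (if n = 0 then lead_coeff (\<phi> 0) * (fourier_coeff w 0 + caratheodory_fun w z)
      else circ_int (\<lambda>\<zeta>. (\<zeta> + z) / (\<zeta> - z) * w \<zeta> * poly (\<phi> n) \<zeta>))"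

definition assoc_star_fun ::
    "(complex \<Rightarrow> complex) \<Rightarrow> (nat \<Rightarrow> complex poly) \<Rightarrow> nat \<Rightarrow> complex \<Rightarrow> complex" where
  "assoc_star_fun w \<psi> n z =
     (if n = 0 then lead_coeff (\<psi> 0) * (fourier_coeff w 0 - caratheodory_fun w z)
      else - (z ^ n) * circ_int (\<lambda>\<zeta>. (\<zeta> + z) / (\<zeta> - z) * w \<zeta> * poly (\<psi> n) (1 / \<zeta>)))"

definition r_coeff :: "(nat \<Rightarrow> complex poly) \<Rightarrow> nat \<Rightarrow> complex" where
  "r_coeff \<phi> n = poly (\<phi> n) 0 / lead_coeff (\<phi> n)"

definition row_det :: "complex list list \<Rightarrow> complex" where
  "row_det rs = Determinant.det (mat_of_rows_list (length rs) rs)"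

definition v_row :: "nat \<Rightarrow> nat \<Rightarrow> (nat \<Rightarrow> complex \<Rightarrow> complex) \<Rightarrow> complex \<Rightarrow> complex list" where
  "v_row n L a z = map (\<lambda>m. z powi (- int m) * a m z) [n - L ..< Suc n]"

definition u_row :: "nat \<Rightarrow> nat \<Rightarrow> (nat \<Rightarrow> complex \<Rightarrow> complex) \<Rightarrow> complex \<Rightarrow> complex list" where
  "u_row n L a z = map (\<lambda>m. z powi (- int m) * a m z) [n - L ..< n]"

definition v'_row :: "nat \<Rightarrow> nat \<Rightarrow> (nat \<Rightarrow> complex \<Rightarrow> complex) \<Rightarrow> complex \<Rightarrow> complex list" where
  "v'_row n L a z = map (\<lambda>m. z powi (- int m - 1) * a m z) [n - L ..< Suc n]"

text \<open>The row of length \<open>L + 1\<close> with entries \<open>z\<^sup>L a\<^sub>n\<^sub>-\<^sub>L(z), \<dots>, a\<^sub>n(z)\<close>.\<close>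

definition z_row :: "nat \<Rightarrow> nat \<Rightarrow> (nat \<Rightarrow> complex \<Rightarrow> complex) \<Rightarrow> complex \<Rightarrow> complex list" where
  "z_row n L a z = map (\<lambda>m. z ^ (n - m) * a m z) [n - L ..< Suc n]"

definition c_row :: "nat \<Rightarrow> nat \<Rightarrow> (nat \<Rightarrow> complex) \<Rightarrow> complex list" where
  "c_row n L c = map c [n - L ..< Suc n]"

end

theory Submission
  imports Defs
begin

text \<open>Since \<open>\<Phi>\<^sub>n\<close> is orthogonal to \<open>1, \<dots>, \<zeta>\<^sup>-\<^sup>n\<^sup>+\<^sup>1\<close> for \<open>w / P\<close>, with
  \<open>P(z) = \<Prod>(z - \<beta>\<^sub>j)\<close>, it is a combination \<open>\<Sum> a\<^sub>m z\<^sup>n\<^sup>-\<^sup>m \<phi>\<^sub>m(z)\<close> over \<open>n - L \<le> m \<le> n\<close>.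
  Conversely, by partial fractions such a combination has this orthogonality as soon as its integrals
  against \<open>\<zeta>\<^sup>1\<^sup>-\<^sup>n / (\<zeta> - \<beta>\<^sub>j)\<close> for \<open>w\<close> vanish. Orthogonality of \<open>\<phi>\<^sub>m\<close> gives
  \<open>z\<^sup>-\<^sup>m \<xi>\<^sub>m(z) = 2 \<integral> w(\<zeta>) \<phi>\<^sub>m(\<zeta>) \<zeta>\<^sup>1\<^sup>-\<^sup>m / (\<zeta> - z)\<close>, so these conditions read
  \<open>v(\<xi>, \<beta>\<^sub>j) \<cdot> a = 0\<close>. They are satisfied by the cofactors \<open>a\<^sub>m\<close> of the first row of the
  bordered determinant, which is then \<open>c \<Phi>\<^sub>n(z)\<close>; evaluating its leading coefficient, its value at
  \<open>0\<close>, its pairing with \<open>\<zeta>\<^sup>-\<^sup>n\<close> and its Cauchy transform gives every formula. If a denominator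
  vanished, a kernel vector of its matrix would give a nonzero combination that is a zero multiple of
  \<open>\<Phi>\<^sub>n\<close>. The starred case is the same with the orthogonality range shifted by one.\<close>

subsection \<open>Integration against a weight\<close>

text \<open>The velocity of the circle path is \<open>2 * pi * \<i> * \<zeta>\<close>, which cancels
  the denominator in \<open>circ_int\<close>. What remains is an integral over the parameter
  interval.\<close>

lemma circ_int_eq_integral: "circ_int f = integral {0..1} (\<lambda>t. f (circlepath 0 1 t))"
  unfolding circ_int_def contour_integral_integral
  by (rule integral_cong) (simp add: vector_derivative_circlepath, simp add: circlepath)

lemma norm_circlepath_unit [simp]: "norm (circlepath 0 1 t) = 1"
  by (simp add: circlepath norm_mult)

text \<open>On the compact circle a continuous factor is bounded and measurable, and such a factor
  preserves absolute integrability. This supplies the integrability behind linearity and also makes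
  the modified weight a weight.\<close>

lemma circle_weight_mult:
  assumes "circle_weight w" "continuous_on (sphere 0 1) f"
  shows "circle_weight (\<lambda>z. w z * f z)"
proof -
  let ?g = "\<lambda>t. f (circlepath 0 1 t)"
  have cont: "continuous_on {0..1} ?g"
    by (rule continuous_on_compose2[OF assms(2)])
      (auto intro!: continuous_intros simp: circlepath norm_mult)
  have "bounded (?g ` {0..1})"
    by (intro compact_imp_bounded compact_continuous_image cont compact_Icc)
  moreover have "?g \<in> borel_measurable (lebesgue_on {0..1})"
    by (intro continuous_imp_measurable_on_sets_lebesgue cont) auto
  ultimately have "(\<lambda>t. ?g t * w (circlepath 0 1 t)) absolutely_integrable_on {0..1}"
    using assms(1) unfolding circle_weight_def
    by (intro absolutely_integrable_bounded_measurable_product[OF bilinear_times]) auto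
  then show ?thesis
    unfolding circle_weight_def by (simp add: mult.commute)
qed

text \<open>Separating the weight from the test function turns the integral into a linear functional
  of \<open>f\<close>: continuity is asked of the test functions, integrability alone of the
  weight.\<close>

definition weighted_int :: "(complex \<Rightarrow> complex) \<Rightarrow> (complex \<Rightarrow> complex) \<Rightarrow> complex" where
  "weighted_int w f = circ_int (\<lambda>z. w z * f z)"

lemma weighted_int_cong:
  assumes "\<And>z. norm z = 1 \<Longrightarrow> f z = g z"
  shows "weighted_int w f = weighted_int w g"
  unfolding weighted_int_def circ_int_eq_integral
  by (rule integral_cong) (simp add: assms)

lemma weighted_int_cmult: "weighted_int w (\<lambda>z. c * f z) = c * weighted_int w f"
proof -
  have "weighted_int w (\<lambda>z. c * f z) = integral {0..1} (\<lambda>t. c * (w (circlepath 0 1 t) * f (circlepath 0 1 t)))"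
    unfolding weighted_int_def circ_int_eq_integral by (simp add: algebra_simps)
  then show ?thesis
    unfolding weighted_int_def circ_int_eq_integral by simp
qed

lemma weighted_int_zero [simp]: "weighted_int w (\<lambda>z. 0) = 0"
  using weighted_int_cmult[of w 0 "\<lambda>_. 0"] by simp

lemma weighted_int_sum:
  assumes "circle_weight w" "finite S" "\<And>i. i \<in> S \<Longrightarrow> continuous_on (sphere 0 1) (f i)"
  shows "weighted_int w (\<lambda>z. \<Sum>i\<in>S. c i * f i z) = (\<Sum>i\<in>S. c i * weighted_int w (f i))"
proof -
  have "(\<lambda>t. w (circlepath 0 1 t) * f i (circlepath 0 1 t)) integrable_on {0..1}" if "i \<in> S" for i
    using circle_weight_mult[OF assms(1) assms(3)[OF that]]
    unfolding circle_weight_def by (rule set_lebesgue_integral_eq_integral)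
  then have "(\<lambda>t. w (circlepath 0 1 t) * (c i * f i (circlepath 0 1 t))) integrable_on {0..1}"
    if "i \<in> S" for i
    using integrable_on_mult_right[of "\<lambda>t. w (circlepath 0 1 t) * f i (circlepath 0 1 t)" _ "c i"] that
    by (simp add: mult.left_commute[of _ "c i"])
  then have "weighted_int w (\<lambda>z. \<Sum>i\<in>S. c i * f i z) = (\<Sum>i\<in>S. weighted_int w (\<lambda>z. c i * f i z))"
    unfolding weighted_int_def circ_int_eq_integral sum_distrib_left
    by (rule integral_sum[OF assms(2)])
  then show ?thesis by (simp add: weighted_int_cmult)
qed

lemma weighted_int_add:
  assumes "circle_weight w" "continuous_on (sphere 0 1) f" "continuous_on (sphere 0 1) g"
  shows "weighted_int w (\<lambda>z. f z + g z) = weighted_int w f + weighted_int w g"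
  using weighted_int_sum[OF assms(1), of "{False, True}" "\<lambda>b. if b then g else f" "\<lambda>_. 1"] assms(2,3)
  by (simp add: add.commute)

lemma weighted_int_diff:
  assumes "circle_weight w" "continuous_on (sphere 0 1) f" "continuous_on (sphere 0 1) g"
  shows "weighted_int w (\<lambda>z. f z - g z) = weighted_int w f - weighted_int w g"
  using weighted_int_add[OF assms(1,2), of "\<lambda>z. - 1 * g z"] assms(3)
    weighted_int_cmult[of w "- 1" g]
  by (simp add: continuous_on_minus)

lemma weighted_int_divide: "weighted_int (\<lambda>z. w z / q z) f = weighted_int w (\<lambda>z. f z / q z)"
  unfolding weighted_int_def by simp

lemma continuous_on_sphere_powi [continuous_intros]: "continuous_on (sphere 0 1) (\<lambda>z::complex. z powi k)"
  by (rule continuous_on_power_int) auto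

lemma continuous_on_sphere_poly [continuous_intros]: "continuous_on (sphere (0::complex) 1) (poly p)"
  by (rule continuous_on_poly) (rule continuous_on_id)

lemma continuous_on_sphere_poly_inverse [continuous_intros]:
  "continuous_on (sphere (0::complex) 1) (\<lambda>z. poly p (1 / z))"
  by (rule continuous_on_poly) (auto intro!: continuous_intros)

lemma poly_inverse_eq_powi:
  "z \<noteq> 0 \<Longrightarrow> degree p \<le> d \<Longrightarrow> poly p (1 / z) = (\<Sum>i\<le>d. coeff p i * z powi (- int i))" for z :: complex
  unfolding poly_altdef
  by (rule sum.mono_neutral_cong_left)
    (auto simp: coeff_eq_0 power_int_minus power_one_over divide_simps)

subsection \<open>Bordered determinants\<close>

lemma mat_of_rows_list_carrier [simp]:
  "mat_of_rows_list nc rs \<in> carrier_mat (length rs) nc"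
  by (simp add: mat_of_rows_list_def)

text \<open>Each term of the Leibniz formula contains exactly one entry from every row.\<close>

lemma row_det_scale_rows:
  assumes "length xs = length ys" "\<And>i. i < length xs \<Longrightarrow> length (ys ! i) = length xs"
    "\<And>i. i < length xs \<Longrightarrow> xs ! i = map ((*) (s i)) (ys ! i)"
  shows "row_det xs = (\<Prod>i<length xs. s i) * row_det ys"
proof -
  have "(\<Prod>i<length xs. mat_of_rows_list (length xs) xs $$ (i, p i)) =
      (\<Prod>i<length xs. s i) * (\<Prod>i<length xs. mat_of_rows_list (length ys) ys $$ (i, p i))"
    if "p permutes {0..<length xs}" for p
    unfolding prod.distrib[symmetric]
  proof (rule prod.cong[OF refl])
    fix i assume "i \<in> {..<length xs}"
    then have "i < length xs" "p i < length xs"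
      using permutes_in_image[OF that, of i] by auto
    then show "mat_of_rows_list (length xs) xs $$ (i, p i) =
        s i * mat_of_rows_list (length ys) ys $$ (i, p i)"
      using assms by (simp add: mat_of_rows_list_def)
  qed
  then show ?thesis
    unfolding row_det_def det_def'[OF mat_of_rows_list_carrier] sum_distrib_left using assms(1)
    by (intro sum.cong) (simp_all add: atLeast0LessThan mult.left_commute)
qed

declare upt_Suc [simp del]

text \<open>The first fact is Laplace expansion along the first row, and the second is the same
  expansion of a determinant with a repeated row. The third reads off the last cofactor, and the
  fourth is a null vector of a singular matrix.\<close>

lemma bordered_row_det:
  fixes v :: "nat \<Rightarrow> nat \<Rightarrow> complex"
  assumes "L \<le> n"
  defines "D \<equiv> \<lambda>f. row_det (map f [n - L..<Suc n] # map (\<lambda>j. map (v j) [n - L..<Suc n]) [1..<Suc L])"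
  obtains cof where
    "\<And>f. D f = (\<Sum>m=n-L..n. f m * cof m)"
    "\<And>j. j \<in> {1..L} \<Longrightarrow> (\<Sum>m=n-L..n. v j m * cof m) = 0"
    "cof n = (-1) ^ L * row_det (map (\<lambda>j. map (v j) [n - L..<n]) [1..<Suc L])"
    "\<And>f. D f = 0 \<Longrightarrow> \<exists>a. (\<exists>m\<in>{n-L..n}. a m \<noteq> 0) \<and> (\<Sum>m=n-L..n. f m * a m) = 0 \<and>
        (\<forall>j\<in>{1..L}. (\<Sum>m=n-L..n. v j m * a m) = 0)"
proof -
  define R where "R = map (\<lambda>j. map (v j) [n - L..<Suc n]) [1..<Suc L]"
  define M where "M f = mat_of_rows_list (Suc L) (map f [n - L..<Suc n] # R)" for f
  have lenR: "length R = L" by (simp add: R_def)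
  have M: "M f \<in> carrier_mat (Suc L) (Suc L)" for f
    using lenR by (auto simp: M_def mat_of_rows_list_def)
  have D: "D f = det (M f)" for f
    unfolding D_def row_det_def M_def R_def by simp
  have M0: "M f $$ (0, i) = f (n - L + i)" if "i \<le> L" for f i
    using that lenR assms(1) by (simp add: M_def mat_of_rows_list_def nth_append)
  have MS: "M f $$ (j, i) = v j (n - L + i)" if "i \<le> L" "j \<in> {1..L}" for f i j
    using that lenR assms(1)
    by (cases j) (auto simp: M_def mat_of_rows_list_def R_def)
  have delete: "mat_delete (M f) 0 i = mat_delete (M g) 0 i" for f g i
    using lenR by (intro eq_matI) (auto simp: mat_delete_def M_def mat_of_rows_list_def)
  have shift: "(\<Sum>m=n-L..n. g m) = (\<Sum>i<Suc L. g (n - L + i))" for g :: "nat \<Rightarrow> complex"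
    using assms(1)
    by (intro sum.reindex_bij_witness[of _ "\<lambda>i. n - L + i" "\<lambda>m. m - (n - L)"]) auto
  \<comment> \<open>A cofactor of row 0 does not depend on row 0. The zero row is a placeholder, and
    one \<open>cof\<close> serves all \<open>f\<close>.\<close>
  define cof where "cof m = cofactor (M (\<lambda>_. 0)) 0 (m - (n - L))" for m
  have expand: "D f = (\<Sum>m=n-L..n. f m * cof m)" for f
    unfolding D shift laplace_expansion_row[OF M, of 0, simplified zero_less_Suc, OF TrueI]
    by (intro sum.cong refl) (auto simp: M0 cof_def cofactor_def delete[of f _ "\<lambda>_. 0"])
  show thesis
  proof
    show "D f = (\<Sum>m=n-L..n. f m * cof m)" for f by (rule expand)
  next
    fix j assume j: "j \<in> {1..L}"
    \<comment> \<open>With \<open>v j\<close> itself as first row, rows 0 and \<open>j\<close>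
      coincide.\<close>
    have "Matrix.row (M (v j)) 0 = Matrix.row (M (v j)) j"
      using M[of "v j"] j by (intro eq_vecI) (auto simp: M0 MS less_Suc_eq_le)
    then have "det (M (v j)) = 0"
      using j by (intro det_identical_rows[OF M, of 0 j]) auto
    then show "(\<Sum>m=n-L..n. v j m * cof m) = 0"
      using expand[of "v j"] D by simp
  next
    have "mat_delete (M (\<lambda>_. 0)) 0 L =
        mat_of_rows_list L (map (\<lambda>j. map (v j) [n - L..<n]) [1..<Suc L])"
      using assms(1) M[of "\<lambda>_. 0"]
      by (intro eq_matI)
        (auto simp: mat_delete_def MS mat_of_rows_list_def)
    then show "cof n = (-1) ^ L * row_det (map (\<lambda>j. map (v j) [n - L..<n]) [1..<Suc L])"
      using assms(1) by (simp add: cof_def cofactor_def row_det_def)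
  next
    fix f assume "D f = 0"
    then obtain x where x: "x \<in> carrier_vec (Suc L)" "x \<noteq> 0\<^sub>v (Suc L)" "M f *\<^sub>v x = 0\<^sub>v (Suc L)"
      using det_0_iff_vec_prod_zero[OF M, of f] D by auto
    have mult: "(\<Sum>i<Suc L. M f $$ (j, i) * vec_index x i) = 0" if "j \<le> L" for j
    proof -
      have "vec_index (M f *\<^sub>v x) j = 0" using x(3) that by simp
      then show ?thesis
        using that M[of f] x(1) by (simp add: scalar_prod_def atLeast0LessThan)
    qed
    obtain i where i: "i < Suc L" "vec_index x i \<noteq> 0"
      using x(1,2) by (metis eq_vecI carrier_vecD index_zero_vec)
    define a where "a m = vec_index x (m - (n - L))" for m
    have "\<exists>m\<in>{n-L..n}. a m \<noteq> 0"
      using i assms(1) by (intro bexI[of _ "n - L + i"]) (auto simp: a_def)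
    moreover have "(\<Sum>m=n-L..n. f m * a m) = 0"
      unfolding shift using mult[of 0] by (simp add: a_def M0)
    moreover have "(\<Sum>m=n-L..n. v j m * a m) = 0" if "j \<in> {1..L}" for j
      unfolding shift using mult[of j] that by (simp add: a_def MS)
    ultimately show "\<exists>a. (\<exists>m\<in>{n-L..n}. a m \<noteq> 0) \<and> (\<Sum>m=n-L..n. f m * a m) = 0 \<and>
        (\<forall>j\<in>{1..L}. (\<Sum>m=n-L..n. v j m * a m) = 0)" by blast
  qed
qed

subsection \<open>Bi-orthogonal systems\<close>

text \<open>Induction on \<open>d\<close>: subtracting a multiple of \<open>b (Suc d)\<close>
  removes the top coefficient.\<close>

lemma poly_triangular_basis:
  fixes b :: "nat \<Rightarrow> 'a::field poly"
  assumes "\<And>i. degree (b i) = i" "\<And>i. b i \<noteq> 0" "degree p \<le> d"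
  shows "\<exists>c. p = (\<Sum>i\<le>d. Polynomial.smult (c i) (b i))"
  using assms(3)
proof (induction d arbitrary: p)
  case 0
  obtain a where a: "p = [:a:]" using 0 degree_eq_zeroE[of p] by auto
  obtain a' where a': "b 0 = [:a':]" using assms(1)[of 0] degree_eq_zeroE[of "b 0"] by auto
  then have "a' \<noteq> 0" using assms(2)[of 0] by auto
  then show ?case using a a' by (intro exI[of _ "\<lambda>_. a / a'"]) simp
next
  case (Suc d)
  define t where "t = coeff p (Suc d) / lead_coeff (b (Suc d))"
  define q where "q = p - Polynomial.smult t (b (Suc d))"
  have "coeff q i = 0" if "i > d" for i
  proof (cases "i = Suc d")
    case True
    then show ?thesis using leading_coeff_neq_0[OF assms(2)[of "Suc d"]] assms(1)[of "Suc d"] by (simp add: q_def t_def)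
  next
    case False
    then show ?thesis using that Suc.prems assms(1)[of "Suc d"] by (simp add: q_def coeff_eq_0)
  qed
  then have "degree q \<le> d" by (intro degree_le) auto
  from Suc.IH[OF this] obtain c where "q = (\<Sum>i\<le>d. Polynomial.smult (c i) (b i))" by auto
  then have "p = (\<Sum>i\<le>Suc d. Polynomial.smult ((c(Suc d := t)) i) (b i))"
    by (simp add: q_def algebra_simps)
  then show ?case by blast
qed

text \<open>The locale is interpreted twice, for the original and for the modified weight, so that
  both systems share one theory.\<close>

locale biorthogonal =
  fixes w :: "complex \<Rightarrow> complex" and \<phi> \<psi> :: "nat \<Rightarrow> complex poly"
  assumes weight: "circle_weight w" and sys: "biorthogonal_system w \<phi> \<psi>"
begin

abbreviation E where "E \<equiv> weighted_int w"

lemmas E_sum = weighted_int_sum[OF weight]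
lemmas E_add = weighted_int_add[OF weight]
lemmas E_diff = weighted_int_diff[OF weight]

lemma degree_\<phi> [simp]: "degree (\<phi> n) = n" and degree_\<psi> [simp]: "degree (\<psi> n) = n"
  and lead_eq: "coeff (\<psi> n) n = coeff (\<phi> n) n"
  using sys unfolding biorthogonal_system_def by metis+

lemma E_biorth: "E (\<lambda>z. poly (\<phi> m) z * poly (\<psi> n) (1 / z)) = (if m = n then 1 else 0)"
  using sys unfolding biorthogonal_system_def weighted_int_def mult.assoc by blast

lemma \<phi>_nonzero [simp]: "\<phi> n \<noteq> 0" and \<psi>_nonzero [simp]: "\<psi> n \<noteq> 0"
  using E_biorth[of n n] by auto

lemma lead_nonzero [simp]: "coeff (\<phi> n) n \<noteq> 0"
  using leading_coeff_neq_0[OF \<phi>_nonzero, of n] by simp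

text \<open>In an expansion of \<open>p\<close> in the companions \<open>\<psi> i\<close> only
  \<open>i = n\<close> survives the pairing. Its coefficient is found by comparing top coefficients,
  since \<open>\<phi> n\<close> and \<open>\<psi> n\<close> have the same leading
  coefficient.\<close>

lemma E_\<phi>:
  assumes "degree p \<le> n"
  shows "E (\<lambda>z. poly (\<phi> n) z * poly p (1 / z)) = coeff p n / coeff (\<phi> n) n"
proof -
  obtain c where c: "p = (\<Sum>i\<le>n. Polynomial.smult (c i) (\<psi> i))"
    using poly_triangular_basis[of \<psi> p n] assms by auto
  have "coeff p n = (\<Sum>i\<le>n. if i = n then c n * coeff (\<phi> n) n else 0)"
    unfolding c coeff_sum by (intro sum.cong) (auto simp: lead_eq coeff_eq_0)
  moreover have "E (\<lambda>z. poly (\<phi> n) z * poly p (1 / z)) =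
      E (\<lambda>z. \<Sum>i\<le>n. c i * (poly (\<phi> n) z * poly (\<psi> i) (1 / z)))"
    unfolding c by (simp add: poly_sum sum_distrib_left mult.left_commute)
  moreover have "\<dots> = c n"
    by (subst E_sum) (auto intro!: continuous_intros simp: E_biorth if_distrib cong: if_cong)
  ultimately show ?thesis by simp
qed

lemma E_\<psi>:
  assumes "degree p \<le> n"
  shows "E (\<lambda>z. poly p z * poly (\<psi> n) (1 / z)) = coeff p n / coeff (\<phi> n) n"
proof -
  obtain c where c: "p = (\<Sum>i\<le>n. Polynomial.smult (c i) (\<phi> i))"
    using poly_triangular_basis[of \<phi> p n] assms by auto
  have "coeff p n = (\<Sum>i\<le>n. if i = n then c n * coeff (\<phi> n) n else 0)"
    unfolding c coeff_sum by (intro sum.cong) (auto simp: coeff_eq_0)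
  moreover have "E (\<lambda>z. poly p z * poly (\<psi> n) (1 / z)) =
      E (\<lambda>z. \<Sum>i\<le>n. c i * (poly (\<phi> i) z * poly (\<psi> n) (1 / z)))"
    unfolding c by (simp add: poly_sum sum_distrib_right mult.assoc)
  moreover have "\<dots> = c n"
    by (subst E_sum) (auto intro!: continuous_intros simp: E_biorth if_distrib cong: if_cong)
  ultimately show ?thesis by simp
qed

text \<open>The case \<open>k = int n\<close>, the first power beyond the range of orthogonality, is
  the source of the row with entries \<open>1 / \<kappa> m\<close>.\<close>

lemma E_\<phi>_powi:
  assumes "0 \<le> k" "k \<le> int n"
  shows "E (\<lambda>z. poly (\<phi> n) z * z powi (- k)) = (if k = int n then 1 / coeff (\<phi> n) n else 0)"
proof -
  obtain i where i: "k = int i" using assms(1) nonneg_int_cases by blast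
  have "E (\<lambda>z. poly (\<phi> n) z * z powi (- k)) = E (\<lambda>z. poly (\<phi> n) z * poly (monom 1 i) (1 / z))"
    by (rule weighted_int_cong) (simp add: i poly_monom power_int_minus power_one_over inverse_eq_divide)
  also have "\<dots> = (if k = int n then 1 / coeff (\<phi> n) n else 0)"
    using assms(2) i by (subst E_\<phi>) (auto simp: degree_monom_eq)
  finally show ?thesis .
qed

lemma poly_reciprocal:
  assumes "z \<noteq> 0" shows "poly (reciprocal \<psi> n) z = z ^ n * poly (\<psi> n) (1 / z)"
  using assms by (simp add: reciprocal_def poly_reflect_poly_nz inverse_eq_divide)

text \<open>The integrand is \<open>z ^ (n - k)\<close> times the companion at \<open>1 / z\<close>.
  Orthogonality therefore holds for \<open>k\<close> from 1 to \<open>n\<close>, and the exceptional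
  power is \<open>k = 0\<close>.\<close>

lemma E_reciprocal_powi:
  assumes "0 \<le> k" "k \<le> int n"
  shows "E (\<lambda>z. poly (reciprocal \<psi> n) z * z powi (- k)) = (if k = 0 then 1 / coeff (\<phi> n) n else 0)"
proof -
  obtain i where i: "int n - k = int i" using assms nonneg_int_cases[of "int n - k"] by auto
  have "E (\<lambda>z. poly (reciprocal \<psi> n) z * z powi (- k)) =
      E (\<lambda>z. poly (monom 1 i) z * poly (\<psi> n) (1 / z))"
  proof (rule weighted_int_cong)
    fix z :: complex assume "norm z = 1"
    then have z: "z \<noteq> 0" by auto
    have "z ^ n * z powi (- k) = z powi (int n + - k)"
      using z by (subst power_int_add) auto
    also have "\<dots> = z ^ i" using i by simp
    finally show "poly (reciprocal \<psi> n) z * z powi (- k) = poly (monom 1 i) z * poly (\<psi> n) (1 / z)"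
      using z by (simp add: poly_reciprocal poly_monom)
  qed
  also have "\<dots> = (if k = 0 then 1 / coeff (\<phi> n) n else 0)"
    using assms i by (subst E_\<psi>) (auto simp: degree_monom_eq)
  finally show ?thesis .
qed

section \<open>Completeness of the moments and uniqueness of the orthogonal polynomials\<close>

text \<open>Pairing with \<open>\<psi> i\<close> recovers the coefficient of \<open>\<phi> i\<close>
  in \<open>q\<close>, and this pairing is a combination of the vanishing moments.\<close>

lemma complete:
  assumes "degree q \<le> d" "\<And>k. k \<in> {0..int d} \<Longrightarrow> E (\<lambda>z. poly q z * z powi (- k)) = 0"
  shows "q = 0"
proof -
  obtain c where c: "q = (\<Sum>i\<le>d. Polynomial.smult (c i) (\<phi> i))"
    using poly_triangular_basis[of \<phi> q d] assms(1) by auto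
  have "c i = 0" if "i \<le> d" for i
  proof -
    have "E (\<lambda>z. poly q z * poly (\<psi> i) (1 / z)) =
        E (\<lambda>z. \<Sum>k\<le>d. c k * (poly (\<phi> k) z * poly (\<psi> i) (1 / z)))"
      unfolding c by (simp add: poly_sum sum_distrib_right mult.assoc)
    also have "\<dots> = c i"
      using that by (subst E_sum) (auto intro!: continuous_intros simp: E_biorth if_distrib cong: if_cong)
    finally have "c i = E (\<lambda>z. poly q z * poly (\<psi> i) (1 / z))" ..
    also have "\<dots> = E (\<lambda>z. \<Sum>k\<le>i. coeff (\<psi> i) k * (poly q z * z powi (- int k)))"
      by (rule weighted_int_cong, subst poly_inverse_eq_powi[of _ _ i])
        (auto simp: sum_distrib_left mult.left_commute)
    also have "\<dots> = 0"
      using that by (subst E_sum) (auto intro!: continuous_intros sum.neutral assms(2))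
    finally show ?thesis .
  qed
  then show ?thesis unfolding c by (auto intro!: sum.neutral)
qed

text \<open>The multiple of \<open>\<phi> n\<close> is chosen to cancel the coefficient of degree
  \<open>n\<close>. The difference then has degree below \<open>n\<close> and \<open>n\<close>
  vanishing moments, so \<open>complete\<close> applies.\<close>

lemma unique_\<phi>:
  assumes "degree q \<le> n" "\<And>k. k \<in> {0..<int n} \<Longrightarrow> E (\<lambda>z. poly q z * z powi (- k)) = 0"
  shows "q = Polynomial.smult (coeff q n / coeff (\<phi> n) n) (\<phi> n)"
proof -
  let ?c = "coeff q n / coeff (\<phi> n) n"
  define p where "p = q - Polynomial.smult ?c (\<phi> n)"
  have top: "coeff p n = 0" by (simp add: p_def)
  have deg: "degree p \<le> n" unfolding p_def by (rule degree_diff_le) (use assms(1) in auto)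
  have E: "E (\<lambda>z. poly p z * z powi (- k)) = 0" if "k \<in> {0..<int n}" for k
  proof -
    have "E (\<lambda>z. poly p z * z powi (- k)) =
        E (\<lambda>z. poly q z * z powi (- k) - ?c * (poly (\<phi> n) z * z powi (- k)))"
      by (simp add: p_def algebra_simps)
    also have "\<dots> = 0"
      using that assms(2)[OF that] E_\<phi>_powi[of k n]
      by (subst E_diff) (auto intro!: continuous_intros simp: weighted_int_cmult simp del: times_divide_eq_left)
    finally show ?thesis .
  qed
  have "p = 0"
  proof (cases n)
    case 0
    then show ?thesis using deg top by (metis le_zero_eq leading_coeff_0_iff)
  next
    case (Suc d)
    have "degree p \<le> d"
      using deg top Suc by (metis coeff_0_reflect_poly_0_iff le_SucE leading_coeff_0_iff degree_0 zero_le)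
    then show ?thesis using complete[of p d] E Suc by auto
  qed
  then show ?thesis by (simp add: p_def)
qed

lemma reciprocal_at_0 [simp]: "coeff (reciprocal \<psi> n) 0 = coeff (\<phi> n) n"
  by (simp add: reciprocal_def lead_eq)

lemma degree_reciprocal: "degree (reciprocal \<psi> n) \<le> n"
  unfolding reciprocal_def using degree_reflect_poly_le[of "\<psi> n"] by simp

text \<open>Here the constant coefficient is cancelled instead. Dividing the difference by
  \<open>z\<close> lowers its degree and moves the vanishing moments from \<open>1..n\<close> to
  \<open>0..n-1\<close>, where \<open>complete\<close> applies.\<close>

lemma unique_reciprocal:
  assumes "degree q \<le> n" "\<And>k. k \<in> {1..int n} \<Longrightarrow> E (\<lambda>z. poly q z * z powi (- k)) = 0"
  shows "q = Polynomial.smult (coeff q 0 / coeff (\<phi> n) n) (reciprocal \<psi> n)"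
proof -
  let ?c = "coeff q 0 / coeff (\<phi> n) n"
  define p where "p = q - Polynomial.smult ?c (reciprocal \<psi> n)"
  have "coeff p 0 = 0" by (simp add: p_def)
  then obtain r where r: "p = pCons 0 r" by (cases p) auto
  have deg: "degree p \<le> n"
    unfolding p_def by (rule degree_diff_le) (use assms(1) degree_reciprocal[of n] in auto)
  have E: "E (\<lambda>z. poly p z * z powi (- k)) = 0" if "k \<in> {1..int n}" for k
  proof -
    have "E (\<lambda>z. poly p z * z powi (- k)) =
        E (\<lambda>z. poly q z * z powi (- k) - ?c * (poly (reciprocal \<psi> n) z * z powi (- k)))"
      by (simp add: p_def algebra_simps)
    also have "\<dots> = 0"
      using that assms(2)[OF that] E_reciprocal_powi[of k n]
      by (subst E_diff) (auto intro!: continuous_intros simp: weighted_int_cmult simp del: times_divide_eq_left)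
    finally show ?thesis .
  qed
  have "r = 0"
  proof (cases n)
    case 0
    then show ?thesis using deg r by (auto split: if_splits)
  next
    case (Suc d)
    have "E (\<lambda>z. poly r z * z powi (- k)) = 0" if "k \<in> {0..int d}" for k
    proof -
      have "E (\<lambda>z. poly r z * z powi (- k)) = E (\<lambda>z. poly p z * z powi (- (k + 1)))"
      proof (rule weighted_int_cong)
        fix z :: complex assume "norm z = 1"
        then have "z \<noteq> 0" by auto
        then show "poly r z * z powi (- k) = poly p z * z powi (- (k + 1))"
          by (simp add: r power_int_diff)
      qed
      then show ?thesis using E[of "k + 1"] that Suc by auto
    qed
    moreover have "degree r \<le> d" using deg r Suc by (auto split: if_splits)
    ultimately show ?thesis using complete[of r d] by auto
  qed
  then show ?thesis using r by (simp add: p_def)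
qed

section \<open>Associated functions as Cauchy integrals\<close>

text \<open>Since \<open>z / (\<zeta> - z) = \<zeta> / (\<zeta> - z) - 1\<close>, each factor
  \<open>z\<close> trades one negative power of \<open>\<zeta>\<close> for a moment of index below
  \<open>m\<close>, which vanishes.\<close>

lemma E_\<phi>_kernel_shift:
  assumes "z \<noteq> 0" "z \<notin> sphere 0 1" "k \<le> m"
  shows "E (\<lambda>\<zeta>. poly (\<phi> m) \<zeta> * \<zeta> powi (1 - int k) / (\<zeta> - z)) * z ^ k =
    E (\<lambda>\<zeta>. poly (\<phi> m) \<zeta> * \<zeta> / (\<zeta> - z))"
  using assms(3)
proof (induction k)
  case (Suc k)
  have ne: "\<zeta> - z \<noteq> 0" if "norm \<zeta> = 1" for \<zeta> using that assms(2) by auto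
  have "E (\<lambda>\<zeta>. poly (\<phi> m) \<zeta> * \<zeta> powi (1 - int (Suc k)) / (\<zeta> - z)) * z =
      E (\<lambda>\<zeta>. z * (poly (\<phi> m) \<zeta> * \<zeta> powi (1 - int (Suc k)) / (\<zeta> - z)))"
    by (simp only: weighted_int_cmult mult.commute)
  also have "\<dots> = E (\<lambda>\<zeta>. poly (\<phi> m) \<zeta> * \<zeta> powi (1 - int k) / (\<zeta> - z) - poly (\<phi> m) \<zeta> * \<zeta> powi (- int k))"
  proof (rule weighted_int_cong)
    fix \<zeta> :: complex assume "norm \<zeta> = 1"
    then have "\<zeta> \<noteq> 0" "\<zeta> - z \<noteq> 0" using ne by auto
    then show "z * (poly (\<phi> m) \<zeta> * \<zeta> powi (1 - int (Suc k)) / (\<zeta> - z)) =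
        poly (\<phi> m) \<zeta> * \<zeta> powi (1 - int k) / (\<zeta> - z) - poly (\<phi> m) \<zeta> * \<zeta> powi (- int k)"
      by (simp add: power_int_diff power_int_minus field_simps)
  qed
  also have "\<dots> = E (\<lambda>\<zeta>. poly (\<phi> m) \<zeta> * \<zeta> powi (1 - int k) / (\<zeta> - z))"
    using Suc.prems E_\<phi>_powi[of "int k" m] ne
    by (subst E_diff) (auto intro!: continuous_intros)
  finally show ?case using Suc by (simp add: mult.assoc[symmetric])
qed simp

lemma E_one: "E (\<lambda>\<zeta>. 1) = fourier_coeff w 0"
  by (simp add: weighted_int_def fourier_coeff_def)

text \<open>The kernel splits as
  \<open>(\<zeta> + z) / (\<zeta> - z) = 1 + 2 * z / (\<zeta> - z)\<close>.\<close>

lemma caratheodory_kernel: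
  assumes "z \<notin> sphere 0 1" "continuous_on (sphere 0 1) f"
  shows "circ_int (\<lambda>\<zeta>. (\<zeta> + z) / (\<zeta> - z) * w \<zeta> * f \<zeta>) = E f + 2 * z * E (\<lambda>\<zeta>. f \<zeta> / (\<zeta> - z))"
proof -
  have ne: "\<zeta> - z \<noteq> 0" if "norm \<zeta> = 1" for \<zeta> using that assms(1) by auto
  have "circ_int (\<lambda>\<zeta>. (\<zeta> + z) / (\<zeta> - z) * w \<zeta> * f \<zeta>) = E (\<lambda>\<zeta>. (\<zeta> + z) / (\<zeta> - z) * f \<zeta>)"
    unfolding weighted_int_def by (simp add: mult_ac)
  also have "\<dots> = E (\<lambda>\<zeta>. f \<zeta> + 2 * z * (f \<zeta> / (\<zeta> - z)))"
    using ne by (intro weighted_int_cong) (auto simp: field_simps)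
  also have "\<dots> = E f + 2 * z * E (\<lambda>\<zeta>. f \<zeta> / (\<zeta> - z))"
    using ne by (subst E_add) (auto intro!: continuous_intros assms simp: weighted_int_cmult simp del: times_divide_eq_right)
  finally show ?thesis .
qed

text \<open>Both sides equal twice the integral of \<open>\<phi> m\<close> against
  \<open>\<zeta> / (\<zeta> - z)\<close>. For \<open>m > 0\<close> the zeroth moment vanishes; for
  \<open>m = 0\<close> it does not, and the extra term \<open>fourier_coeff w 0\<close> in the
  definition makes the formula uniform.\<close>

lemma assoc_fun_eq:
  assumes "z \<noteq> 0" "z \<notin> sphere 0 1"
  shows "assoc_fun w \<phi> m z = 2 * z ^ m * E (\<lambda>\<zeta>. poly (\<phi> m) \<zeta> * \<zeta> powi (1 - int m) / (\<zeta> - z))"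
proof -
  have ne: "\<zeta> - z \<noteq> 0" if "norm \<zeta> = 1" for \<zeta> using that assms(2) by auto
  define K where "K = E (\<lambda>\<zeta>. poly (\<phi> m) \<zeta> / (\<zeta> - z))"
  have "E (\<lambda>\<zeta>. poly (\<phi> m) \<zeta> * \<zeta> / (\<zeta> - z)) = E (\<lambda>\<zeta>. poly (\<phi> m) \<zeta> + z * (poly (\<phi> m) \<zeta> / (\<zeta> - z)))"
    using ne by (intro weighted_int_cong) (auto simp: field_simps)
  also have "\<dots> = E (poly (\<phi> m)) + z * K"
    using ne unfolding K_def
    by (subst E_add) (auto intro!: continuous_intros simp: weighted_int_cmult simp del: times_divide_eq_right)
  finally have 1: "2 * z ^ m * E (\<lambda>\<zeta>. poly (\<phi> m) \<zeta> * \<zeta> powi (1 - int m) / (\<zeta> - z)) =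
      2 * (E (poly (\<phi> m)) + z * K)"
    using E_\<phi>_kernel_shift[OF assms order.refl, of m] by (simp add: mult_ac)
  show ?thesis
  proof (cases "m = 0")
    case True
    then obtain c where c: "\<phi> m = [:c:]" using degree_eq_zeroE[of "\<phi> 0"] by auto
    have "E (poly (\<phi> m)) = c * E (\<lambda>_. 1)" "K = c * E (\<lambda>\<zeta>. 1 / (\<zeta> - z))"
      unfolding K_def weighted_int_cmult[symmetric] c by (auto intro!: weighted_int_cong)
    then show ?thesis
      unfolding 1 using True caratheodory_kernel[OF assms(2), of "\<lambda>_. 1"] c
      by (simp add: assoc_fun_def caratheodory_fun_def E_one algebra_simps)
  next
    case False
    then show ?thesis
      unfolding 1 using caratheodory_kernel[OF assms(2), of "poly (\<phi> m)"] E_\<phi>_powi[of 0 m]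
      by (simp add: assoc_fun_def K_def continuous_intros)
  qed
qed

text \<open>At the origin the kernel is 1 and leaves the zeroth moment. This point is excluded in
  \<open>assoc_fun_eq\<close>.\<close>

lemma assoc_fun_at_0:
  assumes "m > 0" shows "assoc_fun w \<phi> m 0 = 0"
  using assms caratheodory_kernel[of 0 "poly (\<phi> m)"] E_\<phi>_powi[of 0 m]
  by (simp add: assoc_fun_def continuous_intros)

text \<open>On the circle the reciprocal polynomial times \<open>\<zeta> powi (- int m)\<close> is
  the companion at \<open>1 / \<zeta>\<close>, so no shift of the kernel is involved. The summand 1
  of the kernel contributes nothing for \<open>m > 0\<close> and is cancelled by
  \<open>fourier_coeff w 0\<close> for \<open>m = 0\<close>.\<close>

lemma assoc_star_fun_eq:
  assumes "z \<notin> sphere 0 1"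
  shows "assoc_star_fun w \<psi> m z =
    - 2 * z ^ Suc m * E (\<lambda>\<zeta>. poly (reciprocal \<psi> m) \<zeta> * \<zeta> powi (- int m) / (\<zeta> - z))"
proof -
  have rec: "poly (reciprocal \<psi> m) \<zeta> * \<zeta> powi (- int m) = poly (\<psi> m) (1 / \<zeta>)" if "norm \<zeta> = 1" for \<zeta>
  proof -
    have "\<zeta> \<noteq> 0" using that by auto
    then show ?thesis by (simp add: poly_reciprocal power_int_minus)
  qed
  have 1: "E (\<lambda>\<zeta>. poly (reciprocal \<psi> m) \<zeta> * \<zeta> powi (- int m) / (\<zeta> - z)) =
      E (\<lambda>\<zeta>. poly (\<psi> m) (1 / \<zeta>) / (\<zeta> - z))"
    by (rule weighted_int_cong) (simp add: rec)
  show ?thesis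
  proof (cases "m = 0")
    case True
    then obtain c where c: "\<psi> m = [:c:]" using degree_eq_zeroE[of "\<psi> 0"] by auto
    have "E (\<lambda>\<zeta>. poly (\<psi> m) (1 / \<zeta>) / (\<zeta> - z)) = c * E (\<lambda>\<zeta>. 1 / (\<zeta> - z))"
      unfolding weighted_int_cmult[symmetric] by (simp add: c)
    then show ?thesis
      unfolding 1 using True caratheodory_kernel[OF assms, of "\<lambda>_. 1"] c
      by (simp add: assoc_star_fun_def caratheodory_fun_def E_one algebra_simps)
  next
    case False
    have "E (\<lambda>\<zeta>. poly (\<psi> m) (1 / \<zeta>)) = 0"
      using E_\<psi>[of "1" m] False by simp
    then show ?thesis
      unfolding 1 using False caratheodory_kernel[OF assms, of "\<lambda>\<zeta>. poly (\<psi> m) (1 / \<zeta>)"]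
      by (simp add: assoc_star_fun_def continuous_intros)
  qed
qed

end

subsection \<open>Division of the weight by a polynomial\<close>

text \<open>No orthogonal polynomials are fixed here, so the results serve the polynomials and their
  reciprocals alike.\<close>

locale rational_modification =
  fixes w :: "complex \<Rightarrow> complex" and \<beta> :: "nat \<Rightarrow> complex" and L n :: nat
  assumes weight: "circle_weight w" and L_pos: "L \<ge> 1" and L_le: "L \<le> n"
    and distinct: "inj_on \<beta> {1..L}" and off_circle: "\<And>j. j \<in> {1..L} \<Longrightarrow> \<beta> j \<notin> sphere 0 1"
begin

abbreviation E where "E \<equiv> weighted_int w"

definition P where "P = (\<Prod>j=1..L. [:- \<beta> j, 1:])"

lemma poly_P: "poly P z = (\<Prod>j=1..L. z - \<beta> j)"
  by (simp add: P_def poly_prod)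

lemma degree_P: "degree P = L" and P_nonzero: "P \<noteq> 0"
  by (simp_all add: P_def degree_prod_eq_sum_degree)

lemma off_circle_nonzero: "j \<in> {1..L} \<Longrightarrow> norm z = 1 \<Longrightarrow> z - \<beta> j \<noteq> 0"
  using off_circle by fastforce

lemma P_circle_nonzero: "norm z = 1 \<Longrightarrow> poly P z \<noteq> 0"
  using off_circle_nonzero by (simp add: poly_P)

text \<open>Lagrange interpolation: \<open>q\<close> agrees with \<open>p\<close> at the
  \<open>L\<close> distinct nodes \<open>\<beta> j\<close>, and both have degree below
  \<open>L\<close>.\<close>

lemma partial_fractions:
  assumes "degree p < L"
  shows "\<exists>r. \<forall>z. poly P z \<noteq> 0 \<longrightarrow> poly p z / poly P z = (\<Sum>j=1..L. r j * (1 / (z - \<beta> j)))"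
proof -
  define R where "R j = (\<Prod>i\<in>{1..L}-{j}. [:- \<beta> i, 1:])" for j
  \<comment> \<open>This is the residue of \<open>p / P\<close> at \<open>\<beta> j\<close>, because
    \<open>R j\<close> is \<open>P\<close> without its factor vanishing there.\<close>
  define r where "r j = poly p (\<beta> j) / poly (R j) (\<beta> j)" for j
  define q where "q = (\<Sum>j=1..L. Polynomial.smult (r j) (R j))"
  have R_root: "poly (R j) (\<beta> i) = 0 \<longleftrightarrow> i \<noteq> j" if "i \<in> {1..L}" "j \<in> {1..L}" for i j
    using that inj_on_eq_iff[OF distinct] by (auto simp: R_def poly_prod)
  have "degree (R j) = L - 1" if "j \<in> {1..L}" for j
    using that by (simp add: R_def degree_prod_eq_sum_degree)
  then have "degree q \<le> L - 1"
    unfolding q_def by (intro degree_sum_le) (auto intro: order.trans[OF degree_smult_le])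
  then have deg_q: "degree q < L" using L_pos by linarith
  have "p = q"
  proof (rule poly_eqI_degree[of "\<beta> ` {1..L}"])
    fix x assume "x \<in> \<beta> ` {1..L}"
    then obtain i where i: "i \<in> {1..L}" "x = \<beta> i" by auto
    have "poly q x = (\<Sum>j=1..L. if j = i then poly p x else 0)"
      unfolding q_def poly_sum using i R_root by (intro sum.cong) (auto simp: r_def)
    then show "poly p x = poly q x" using i(1) by simp
  next
    have card: "card (\<beta> ` {1..L}) = L" using card_image[OF distinct] by simp
    show "degree p < card (\<beta> ` {1..L})" "degree q < card (\<beta> ` {1..L})"
      using assms deg_q unfolding card by auto
  qed
  moreover have "poly (R j) z / poly P z = 1 / (z - \<beta> j)" if "j \<in> {1..L}" "poly P z \<noteq> 0" for j z
  proof -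
    have "P = [:- \<beta> j, 1:] * R j"
      unfolding P_def R_def using that(1) by (intro prod.remove) auto
    then have "poly P z = poly [:- \<beta> j, 1:] z * poly (R j) z"
      unfolding poly_mult[symmetric] by (rule arg_cong)
    then have "poly P z = (z - \<beta> j) * poly (R j) z" by simp
    then show ?thesis using that(2) by auto
  qed
  ultimately have "poly p z / poly P z = (\<Sum>j=1..L. r j * (1 / (z - \<beta> j)))" if "poly P z \<noteq> 0" for z
    using that by (simp add: q_def poly_sum sum_divide_distrib flip: times_divide_eq_right)
  then show ?thesis by blast
qed

lemma E_mult_poly:
  assumes "continuous_on (sphere 0 1) g"
  shows "E (\<lambda>z. g z * poly p z) = (\<Sum>i\<le>degree p. coeff p i * E (\<lambda>z. g z * z ^ i))"
  unfolding poly_altdef sum_distrib_left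
  using weighted_int_sum[OF weight, of "{..degree p}" "\<lambda>i z. g z * z ^ i" "coeff p"] assms
  by (simp add: continuous_intros mult.left_commute)

text \<open>Division of \<open>p\<close> by \<open>P\<close> with remainder, followed by a partial fraction decomposition of the
  remainder, reduces the claim to the two hypotheses.\<close>

lemma rational_orth:
  assumes g: "continuous_on (sphere 0 1) g"
    and moments: "\<And>i. i < n - L \<Longrightarrow> E (\<lambda>z. g z * z ^ i) = 0"
    and poles: "\<And>j. j \<in> {1..L} \<Longrightarrow> E (\<lambda>z. g z / (z - \<beta> j)) = 0"
    and deg: "degree p < n"
  shows "E (\<lambda>z. g z * poly p z / poly P z) = 0"
proof -
  have "degree (p mod P) < L"
    using degree_mod_less'[OF P_nonzero, of p] L_pos degree_P by (cases "p mod P = 0") auto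
  then obtain r where
    r: "\<And>z. poly P z \<noteq> 0 \<Longrightarrow> poly (p mod P) z / poly P z = (\<Sum>j=1..L. r j * (1 / (z - \<beta> j)))"
    using partial_fractions by blast
  have "E (\<lambda>z. g z * poly p z / poly P z) =
      E (\<lambda>z. g z * poly (p div P) z + (\<Sum>j=1..L. r j * (g z / (z - \<beta> j))))"
  proof (rule weighted_int_cong)
    fix z :: complex assume "norm z = 1"
    note nz = P_circle_nonzero[OF this]
    have "poly p z / poly P z = poly (p div P) z + poly (p mod P) z / poly P z"
      using nz by (subst div_mult_mod_eq[of p P, symmetric], unfold poly_add poly_mult)
        (simp add: field_simps)
    then have "g z * poly p z / poly P z = g z * poly (p div P) z + g z * (poly (p mod P) z / poly P z)"
      by (simp add: distrib_left flip: times_divide_eq_right)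
    then show "g z * poly p z / poly P z =
        g z * poly (p div P) z + (\<Sum>j=1..L. r j * (g z / (z - \<beta> j)))"
      unfolding r[OF nz] by (simp add: sum_distrib_left mult_ac)
  qed
  also have "\<dots> = E (\<lambda>z. g z * poly (p div P) z) + (\<Sum>j=1..L. r j * E (\<lambda>z. g z / (z - \<beta> j)))"
  proof -
    have cont: "continuous_on (sphere 0 1) (\<lambda>z. g z / (z - \<beta> j))" if "j \<in> {1..L}" for j
      using off_circle_nonzero[OF that] by (intro continuous_intros g) auto
    have "continuous_on (sphere 0 1) (\<lambda>z. \<Sum>j=1..L. r j * (g z / (z - \<beta> j)))"
      by (intro continuous_on_sum continuous_on_mult_left cont)
    then show ?thesis
      using weighted_int_sum[OF weight, of "{1..L}" "\<lambda>j z. g z / (z - \<beta> j)" r] cont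
      by (subst weighted_int_add[OF weight]) (intro continuous_intros g, assumption, simp)
  qed
  also have "(\<Sum>j=1..L. r j * E (\<lambda>z. g z / (z - \<beta> j))) = 0"
    using poles by simp
  also have "E (\<lambda>z. g z * poly (p div P) z) = 0"
  proof (cases "p div P = 0")
    case False
    \<comment> \<open>Division by \<open>P\<close> lowers the degree by \<open>L\<close>, which
      brings the quotient into the range covered by \<open>moments\<close>.\<close>
    have "degree (p div P) < n - L"
    proof -
      have "degree (p div P * P) = degree (p div P) + L"
        using False P_nonzero by (simp add: degree_mult_eq degree_P)
      moreover from this have "degree (p div P * P + p mod P) = degree (p div P * P)"
        using \<open>degree (p mod P) < L\<close> by (intro degree_add_eq_left) simp
      ultimately show ?thesis using deg unfolding div_mult_mod_eq by simp
    qed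
    then show ?thesis
      unfolding E_mult_poly[OF g] by (intro sum.neutral ballI) (simp add: moments)
  qed simp
  finally show ?thesis by simp
qed

text \<open>Writing \<open>P(z) = P(\<zeta>) - (\<zeta> - z) * R(\<zeta>)\<close> with
  \<open>R\<close> of degree below \<open>n\<close>, the term with \<open>R\<close> is annihilated
  by \<open>rational_orth\<close>. The point \<open>z\<close> may be 0 or one of the
  \<open>\<beta> j\<close>.\<close>

lemma rational_kernel:
  assumes g: "continuous_on (sphere 0 1) g"
    and moments: "\<And>i. i < n - L \<Longrightarrow> E (\<lambda>z. g z * z ^ i) = 0"
    and poles: "\<And>j. j \<in> {1..L} \<Longrightarrow> E (\<lambda>z. g z / (z - \<beta> j)) = 0"
    and z: "z \<notin> sphere 0 1"
  shows "poly P z * E (\<lambda>\<zeta>. g \<zeta> / (\<zeta> - z) / poly P \<zeta>) = E (\<lambda>\<zeta>. g \<zeta> / (\<zeta> - z))"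
proof -
  have ne: "\<zeta> - z \<noteq> 0" if "norm \<zeta> = 1" for \<zeta> using that z by auto
  have "[:- z, 1:] dvd P - [:poly P z:]" by (simp flip: poly_eq_0_iff_dvd)
  then obtain R where R: "P - [:poly P z:] = [:- z, 1:] * R" by blast
  have "degree R < n"
  proof (cases "R = 0")
    case False
    then have "Suc (degree R) = degree (P - [:poly P z:])"
      unfolding R by (subst degree_mult_eq) auto
    also have "\<dots> \<le> L" by (rule degree_diff_le) (auto simp: degree_P)
    finally show ?thesis using L_le by simp
  qed (use L_pos L_le in auto)
  have "poly P z * E (\<lambda>\<zeta>. g \<zeta> / (\<zeta> - z) / poly P \<zeta>) =
      E (\<lambda>\<zeta>. poly P z * (g \<zeta> / (\<zeta> - z) / poly P \<zeta>))"
    by (simp only: weighted_int_cmult)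
  also have "\<dots> = E (\<lambda>\<zeta>. g \<zeta> / (\<zeta> - z) - g \<zeta> * poly R \<zeta> / poly P \<zeta>)"
  proof (rule weighted_int_cong)
    fix \<zeta> :: complex assume \<zeta>: "norm \<zeta> = 1"
    have "poly (P - [:poly P z:]) \<zeta> = poly ([:- z, 1:] * R) \<zeta>" by (simp only: R)
    then have eq: "poly P z = poly P \<zeta> - (\<zeta> - z) * poly R \<zeta>" by (simp add: algebra_simps)
    show "poly P z * (g \<zeta> / (\<zeta> - z) / poly P \<zeta>) = g \<zeta> / (\<zeta> - z) - g \<zeta> * poly R \<zeta> / poly P \<zeta>"
      unfolding eq using ne[OF \<zeta>] P_circle_nonzero[OF \<zeta>] by (simp add: field_simps)
  qed
  also have "\<dots> = E (\<lambda>\<zeta>. g \<zeta> / (\<zeta> - z)) - E (\<lambda>\<zeta>. g \<zeta> * poly R \<zeta> / poly P \<zeta>)"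
    using ne P_circle_nonzero
    by (subst weighted_int_diff[OF weight]) (auto intro!: continuous_intros g)
  also have "E (\<lambda>\<zeta>. g \<zeta> * poly R \<zeta> / poly P \<zeta>) = 0"
    using \<open>degree R < n\<close> by (intro rational_orth g moments poles)
  finally show ?thesis by simp
qed

section \<open>Combinations of \<open>L + 1\<close> consecutive polynomials\<close>

text \<open>The factor \<open>z ^ (n - m)\<close> matches the entries of \<open>z_row\<close>. After
  multiplication by \<open>z powi (e - int n)\<close> the term with index \<open>m\<close> carries
  \<open>z powi (e - int m)\<close>, the power natural for \<open>f m\<close>.\<close>

definition combination :: "(nat \<Rightarrow> complex poly) \<Rightarrow> (nat \<Rightarrow> complex) \<Rightarrow> complex poly" where
  "combination f a = (\<Sum>m=n-L..n. Polynomial.smult (a m) (monom 1 (n - m) * f m))"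

lemma poly_combination: "poly (combination f a) z = (\<Sum>m=n-L..n. z ^ (n - m) * poly (f m) z * a m)"
  by (simp add: combination_def poly_sum poly_monom mult_ac)

lemma degree_combination:
  assumes "\<And>m. degree (f m) \<le> m"
  shows "degree (combination f a) \<le> n"
  unfolding combination_def
proof (rule degree_sum_le)
  fix m assume m: "m \<in> {n-L..n}"
  have "degree (monom (1::complex) (n - m) * f m) \<le> (n - m) + m"
    by (rule order.trans[OF degree_mult_le]) (intro add_mono degree_monom_le assms)
  then show "degree (Polynomial.smult (a m) (monom 1 (n - m) * f m)) \<le> n"
    using m degree_smult_le[of "a m" "monom 1 (n - m) * f m"] by auto
qed simp

lemma coeff_combination:
  "coeff (combination f a) i = (\<Sum>m=n-L..n. a m * (if n - m \<le> i then coeff (f m) (i - (n - m)) else 0))"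
  unfolding combination_def coeff_sum by (intro sum.cong) (auto simp: coeff_monom_mult)

lemma coeff_combination_top: "coeff (combination f a) n = (\<Sum>m=n-L..n. coeff (f m) m * a m)"
  unfolding coeff_combination by (intro sum.cong) auto

lemma coeff_combination_0: "coeff (combination f a) 0 = a n * coeff (f n) 0"
proof -
  have "coeff (combination f a) 0 = (\<Sum>m=n-L..n. if m = n then a n * coeff (f n) 0 else 0)"
    unfolding coeff_combination by (intro sum.cong) auto
  then show ?thesis by simp
qed

text \<open>The coefficient of degree \<open>n - m\<close> involves only indices from
  \<open>m\<close> to \<open>n\<close>. Starting at \<open>m = n\<close>, the coefficients
  \<open>a m\<close> are thus eliminated one after another.\<close>

lemma combination_eq_0:
  assumes "combination f a = 0" "\<And>m. m \<in> {n-L..n} \<Longrightarrow> coeff (f m) 0 \<noteq> 0"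
  shows "m \<in> {n-L..n} \<Longrightarrow> a m = 0"
proof (induction "n - m" arbitrary: m rule: less_induct)
  case less
  have "a k * (if n - k \<le> n - m then coeff (f k) (n - m - (n - k)) else 0) =
      (if k = m then a m * coeff (f m) 0 else 0)" if "k \<in> {n-L..n}" for k
    using less.hyps[of k] less.prems that by (cases "n - k < n - m") auto
  then have "coeff (combination f a) (n - m) = (\<Sum>k=n-L..n. if k = m then a m * coeff (f m) 0 else 0)"
    unfolding coeff_combination by (intro sum.cong) auto
  then show ?case using less.prems assms by simp
qed

lemma E_combination:
  assumes "continuous_on (sphere 0 1) h"
  shows "E (\<lambda>z. poly (combination f a) z * z powi (e - int n) * h z) =
    (\<Sum>m=n-L..n. E (\<lambda>z. poly (f m) z * z powi (e - int m) * h z) * a m)"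
proof -
  have "E (\<lambda>z. poly (combination f a) z * z powi (e - int n) * h z) =
      E (\<lambda>z. \<Sum>m=n-L..n. a m * (poly (f m) z * z powi (e - int m) * h z))"
  proof (rule weighted_int_cong)
    fix z :: complex assume "norm z = 1"
    then have "z \<noteq> 0" by auto
    then have "z ^ (n - m) * z powi (e - int n) = z powi (e - int m)" if "m \<le> n" for m
      using that by (simp flip: power_int_of_nat power_int_add)
    then show "poly (combination f a) z * z powi (e - int n) * h z =
        (\<Sum>m=n-L..n. a m * (poly (f m) z * z powi (e - int m) * h z))"
      unfolding poly_combination sum_distrib_right
      by (intro sum.cong) (auto simp: mult_ac)
  qed
  also have "\<dots> = (\<Sum>m=n-L..n. a m * E (\<lambda>z. poly (f m) z * z powi (e - int m) * h z))"
    by (rule weighted_int_sum[OF weight]) (auto intro!: continuous_intros assms)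
  finally show ?thesis by (simp add: mult.commute)
qed

text \<open>The shift \<open>s\<close> is \<open>0\<close> for the polynomials \<open>\<phi>\<^sub>m\<close> and \<open>1\<close> for their reciprocals.\<close>

context
  fixes f :: "nat \<Rightarrow> complex poly" and s :: int and a :: "nat \<Rightarrow> complex"
  assumes orth: "\<And>m k. s \<le> k \<Longrightarrow> k < int m + s \<Longrightarrow> E (\<lambda>z. poly (f m) z * z powi (- k)) = 0"
    and poles: "\<And>j. j \<in> {1..L} \<Longrightarrow>
      (\<Sum>m=n-L..n. E (\<lambda>z. poly (f m) z * z powi (1 - s - int m) / (z - \<beta> j)) * a m) = 0"
begin

text \<open>Against \<open>f m\<close> the exponent is \<open>k = int m + s - 1 - int i\<close>; it
  lies in the orthogonality range of \<open>f m\<close> because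
  \<open>i < n - L \<le> m\<close>.\<close>

lemma combination_moments:
  assumes "i < n - L"
  shows "E (\<lambda>z. poly (combination f a) z * z powi (1 - s - int n) * z ^ i) = 0"
proof -
  have "E (\<lambda>z. poly (f m) z * z powi (1 - s - int m) * z ^ i) = 0" if "m \<in> {n-L..n}" for m
  proof -
    have "E (\<lambda>z. poly (f m) z * z powi (1 - s - int m) * z ^ i) =
        E (\<lambda>z. poly (f m) z * z powi (- (int m + s - 1 - int i)))"
    proof (rule weighted_int_cong)
      fix z :: complex assume "norm z = 1"
      then have "z \<noteq> 0" by auto
      then have "z powi (1 - s - int m) * z ^ i = z powi (1 - s - int m + int i)"
        by (simp add: power_int_add)
      then show "poly (f m) z * z powi (1 - s - int m) * z ^ i =
          poly (f m) z * z powi (- (int m + s - 1 - int i))"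
        by (simp add: algebra_simps)
    qed
    then show ?thesis using orth[of "int m + s - 1 - int i" m] that assms by auto
  qed
  then show ?thesis
    by (subst E_combination) (auto intro!: continuous_intros)
qed

lemma combination_poles:
  assumes "j \<in> {1..L}"
  shows "E (\<lambda>z. poly (combination f a) z * z powi (1 - s - int n) / (z - \<beta> j)) = 0"
proof -
  have "continuous_on (sphere 0 1) (\<lambda>z. 1 / (z - \<beta> j))"
    using off_circle_nonzero[OF assms] by (intro continuous_intros) auto
  from E_combination[OF this, of f a "1 - s"] show ?thesis using poles[OF assms] by simp
qed

text \<open>For \<open>k\<close> in this range, \<open>z powi (- k)\<close> is
  \<open>z powi (1 - s - int n)\<close> times a monomial of degree below \<open>n\<close>, so
  \<open>rational_orth\<close> applies.\<close>

lemma combination_orth: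
  assumes "s \<le> k" "k < int n + s"
  shows "E (\<lambda>z. poly (combination f a) z * z powi (- k) / poly P z) = 0"
proof -
  obtain i where i: "int n + s - 1 - k = int i"
    using assms nonneg_int_cases[of "int n + s - 1 - k"] by auto
  have "E (\<lambda>z. poly (combination f a) z * z powi (- k) / poly P z) =
      E (\<lambda>z. poly (combination f a) z * z powi (1 - s - int n) * poly (monom 1 i) z / poly P z)"
  proof (rule weighted_int_cong)
    fix z :: complex assume "norm z = 1"
    then have "z \<noteq> 0" by auto
    then have "z powi (1 - s - int n) * z ^ i = z powi (1 - s - int n + int i)"
      by (simp add: power_int_add)
    also have "1 - s - int n + int i = - k" using i by simp
    finally show "poly (combination f a) z * z powi (- k) / poly P z =
        poly (combination f a) z * z powi (1 - s - int n) * poly (monom 1 i) z / poly P z"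
      by (simp add: poly_monom)
  qed
  also have "\<dots> = 0"
    using assms i
    by (intro rational_orth combination_moments combination_poles)
      (auto intro!: continuous_intros simp: degree_monom_eq)
  finally show ?thesis .
qed

text \<open>The transform for the modified weight is reduced to transforms for \<open>w\<close>:
  \<open>rational_kernel\<close> removes \<open>P\<close> from the denominator and linearity does
  the rest.\<close>

lemma combination_kernel:
  assumes "z \<notin> sphere 0 1"
  shows "poly P z * E (\<lambda>\<zeta>. poly (combination f a) \<zeta> * \<zeta> powi (1 - s - int n) / (\<zeta> - z) / poly P \<zeta>) =
    (\<Sum>m=n-L..n. E (\<lambda>\<zeta>. poly (f m) \<zeta> * \<zeta> powi (1 - s - int m) / (\<zeta> - z)) * a m)"
proof -
  have "continuous_on (sphere 0 1) (\<lambda>\<zeta>. 1 / (\<zeta> - z))"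
    using assms by (intro continuous_intros) auto
  from E_combination[OF this, of f a "1 - s"]
  have "E (\<lambda>\<zeta>. poly (combination f a) \<zeta> * \<zeta> powi (1 - s - int n) / (\<zeta> - z)) =
      (\<Sum>m=n-L..n. E (\<lambda>\<zeta>. poly (f m) \<zeta> * \<zeta> powi (1 - s - int m) / (\<zeta> - z)) * a m)"
    by simp
  then show ?thesis
    using assms
    by (subst rational_kernel) (auto intro!: continuous_intros combination_moments combination_poles)
qed

end

end

subsection \<open>The determinant formulas\<close>

text \<open>The genericity hypotheses enter as nonzero constant coefficients. Those of
  \<open>\<phi> m\<close> make the shifted polynomials independent, and that of
  \<open>\<Phi> n\<close> keeps the minor for \<open>\<xi>\<close> away from zero.\<close>

locale modified_system =
  rational_modification w \<beta> L n + orig: biorthogonal w \<phi> \<psi> +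
  hat: biorthogonal "\<lambda>z. w z / (\<Prod>j=1..L. z - \<beta> j)" \<Phi> \<Psi>
  for w \<beta> L n \<phi> \<psi> \<Phi> \<Psi> +
  assumes \<beta>_nonzero: "\<And>j. j \<in> {1..L} \<Longrightarrow> \<beta> j \<noteq> 0"
    and \<phi>_0_nonzero: "\<And>m. m \<ge> 1 \<Longrightarrow> coeff (\<phi> m) 0 \<noteq> 0"
    and \<Phi>_0_nonzero: "coeff (\<Phi> n) 0 \<noteq> 0"
begin

abbreviation what where "what \<equiv> \<lambda>z. w z / (\<Prod>j=1..L. z - \<beta> j)"
abbreviation \<xi> where "\<xi> \<equiv> assoc_fun w \<phi>"
abbreviation \<xi>s where "\<xi>s \<equiv> assoc_star_fun w \<psi>"
abbreviation \<kappa> where "\<kappa> m \<equiv> coeff (\<phi> m) m"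
abbreviation \<kappa>h where "\<kappa>h \<equiv> coeff (\<Phi> n) n"
abbreviation \<phi>s where "\<phi>s \<equiv> reciprocal \<psi>"
abbreviation \<Phi>s where "\<Phi>s \<equiv> reciprocal \<Psi>"
abbreviation kernel where
  "kernel v a \<equiv> \<forall>j\<in>{1..L}. (\<Sum>m=n-L..n. v (\<beta> j) m * a m) = (0::complex)"

lemma n_pos: "n > 0" using L_pos L_le by simp

lemma hat_E: "hat.E f = E (\<lambda>z. f z / poly P z)"
  unfolding weighted_int_divide poly_P ..

lemma P_0: "poly P 0 = (-1) ^ L * (\<Prod>j=1..L. \<beta> j)"
  unfolding poly_P using prod.distrib[of "\<lambda>_. -1" \<beta> "{1..L}"] by simp

lemma P_0_nonzero: "poly P 0 \<noteq> 0"
  unfolding P_0 using \<beta>_nonzero by simp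

text \<open>The kernel condition is the pole condition at the \<open>\<beta> j\<close>, so the
  combination has the orthogonality that characterises \<open>\<Phi> n\<close>. The two identities
  for \<open>c\<close> are \<open>combination_kernel\<close> at 0 and at a general point.\<close>

lemma combination_\<phi>:
  assumes "kernel (\<lambda>z m. z powi (- int m) * \<xi> m z) a"
  obtains c where "combination \<phi> a = Polynomial.smult c (\<Phi> n)"
    "c * poly P 0 = \<kappa>h * (\<Sum>m=n-L..n. 1 / \<kappa> m * a m)"
    "\<And>z. z \<notin> sphere 0 1 \<Longrightarrow> poly P z * (c * assoc_fun what \<Phi> n z) = (\<Sum>m=n-L..n. z ^ (n - m) * \<xi> m z * a m)"
proof -
  have \<xi>: "z powi (- int m) * \<xi> m z = 2 * E (\<lambda>\<zeta>. poly (\<phi> m) \<zeta> * \<zeta> powi (1 - int m) / (\<zeta> - z))"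
    if "z \<noteq> 0" "z \<notin> sphere 0 1" for z m
    unfolding orig.assoc_fun_eq[OF that] using that by (simp add: power_int_minus)
  have poles: "(\<Sum>m=n-L..n. E (\<lambda>\<zeta>. poly (\<phi> m) \<zeta> * \<zeta> powi (1 - 0 - int m) / (\<zeta> - \<beta> j)) * a m) = 0"
    if "j \<in> {1..L}" for j
  proof -
    have "(\<Sum>m=n-L..n. \<beta> j powi (- int m) * \<xi> m (\<beta> j) * a m) = 0" using assms that by blast
    then show ?thesis
      unfolding \<xi>[OF \<beta>_nonzero[OF that] off_circle[OF that]] mult.assoc
      by (simp flip: sum_distrib_left)
  qed
  have orth: "E (\<lambda>z. poly (\<phi> m) z * z powi (- k)) = 0" if "0 \<le> k" "k < int m + 0" for m k
    using orig.E_\<phi>_powi[of k m] that by simp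
  have comb_orth: "E (\<lambda>z. poly (combination \<phi> a) z * z powi (- k) / poly P z) = 0"
    if "0 \<le> k" "k < int n + 0" for k
    by (rule combination_orth[OF orth poles that])
  have comb_kernel:
    "poly P z * E (\<lambda>\<zeta>. poly (combination \<phi> a) \<zeta> * \<zeta> powi (1 - 0 - int n) / (\<zeta> - z) / poly P \<zeta>) =
      (\<Sum>m=n-L..n. E (\<lambda>\<zeta>. poly (\<phi> m) \<zeta> * \<zeta> powi (1 - 0 - int m) / (\<zeta> - z)) * a m)"
    if "z \<notin> sphere 0 1" for z
    by (rule combination_kernel[OF orth poles that])
  define c where "c = coeff (combination \<phi> a) n / \<kappa>h"
  have c: "combination \<phi> a = Polynomial.smult c (\<Phi> n)"
    unfolding c_def
  proof (rule hat.unique_\<phi>)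
    show "hat.E (\<lambda>z. poly (combination \<phi> a) z * z powi (- k)) = 0" if "k \<in> {0..<int n}" for k
      unfolding hat_E using that by (intro comb_orth) auto
  qed (simp add: degree_combination)
  have E_comb: "E (\<lambda>z. poly (combination \<phi> a) z * g z / poly P z) = c * hat.E (\<lambda>z. poly (\<Phi> n) z * g z)" for g
    unfolding hat_E c weighted_int_cmult[symmetric] by (simp add: mult.assoc)
  \<comment> \<open>At \<open>z = 0\<close> the Cauchy kernel contributes one more negative power,
    so the transform becomes the moment against \<open>\<zeta> powi (- int m)\<close>, which is
    \<open>1 / \<kappa> m\<close> for \<open>\<phi> m\<close>.\<close>
  have at0: "E (\<lambda>\<zeta>. q \<zeta> * \<zeta> powi (1 - 0 - int m) / (\<zeta> - 0) / p \<zeta>) = E (\<lambda>\<zeta>. q \<zeta> * \<zeta> powi (- int m) / p \<zeta>)"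
    for q p m
  proof (rule weighted_int_cong)
    fix \<zeta> :: complex assume "norm \<zeta> = 1"
    then have "\<zeta> \<noteq> 0" by auto
    then show "q \<zeta> * \<zeta> powi (1 - 0 - int m) / (\<zeta> - 0) / p \<zeta> = q \<zeta> * \<zeta> powi (- int m) / p \<zeta>"
      by (simp add: power_int_diff power_int_minus field_simps)
  qed
  have "poly P 0 * (c * (1 / \<kappa>h)) = (\<Sum>m=n-L..n. 1 / \<kappa> m * a m)"
    using comb_kernel[of 0] E_comb[of "\<lambda>z. z powi (- int n)"] hat.E_\<phi>_powi[of "int n" n]
      orig.E_\<phi>_powi[of "int m" m for m] at0[of _ _ "\<lambda>_. 1"] at0[of _ _ "poly P"]
    by simp
  then have "c * poly P 0 = \<kappa>h * (\<Sum>m=n-L..n. 1 / \<kappa> m * a m)"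
    using hat.lead_nonzero[of n] by (simp add: field_simps)
  moreover have "poly P z * (c * assoc_fun what \<Phi> n z) = (\<Sum>m=n-L..n. z ^ (n - m) * \<xi> m z * a m)"
    if z: "z \<notin> sphere 0 1" for z
  proof (cases "z = 0")
    case True
    \<comment> \<open>Terms with \<open>m < n\<close> vanish through the power of \<open>z\<close>,
      the term \<open>m = n\<close> through \<open>assoc_fun_at_0\<close>.\<close>
    have "(\<Sum>m=n-L..n. z ^ (n - m) * \<xi> m z * a m) = 0"
    proof (rule sum.neutral, rule ballI)
      fix m assume "m \<in> {n-L..n}"
      then show "z ^ (n - m) * \<xi> m z * a m = 0"
        using True orig.assoc_fun_at_0 n_pos by (cases "m = n") auto
    qed
    then show ?thesis using True hat.assoc_fun_at_0[OF n_pos] by simp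
  next
    case False
    have "c * assoc_fun what \<Phi> n z =
        2 * z ^ n * E (\<lambda>\<zeta>. poly (combination \<phi> a) \<zeta> * \<zeta> powi (1 - 0 - int n) / (\<zeta> - z) / poly P \<zeta>)"
      using hat.assoc_fun_eq[OF False z, of n] E_comb[of "\<lambda>\<zeta>. \<zeta> powi (1 - int n) / (\<zeta> - z)"] by simp
    then have "poly P z * (c * assoc_fun what \<Phi> n z) =
        2 * z ^ n * (\<Sum>m=n-L..n. E (\<lambda>\<zeta>. poly (\<phi> m) \<zeta> * \<zeta> powi (1 - 0 - int m) / (\<zeta> - z)) * a m)"
      unfolding comb_kernel[OF z, symmetric] by simp
    also have "\<dots> = (\<Sum>m=n-L..n. z ^ n * (z powi (- int m) * \<xi> m z) * a m)"
      unfolding \<xi>[OF False z] by (simp add: sum_distrib_left mult_ac)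
    also have "\<dots> = (\<Sum>m=n-L..n. z ^ (n - m) * \<xi> m z * a m)"
      using False by (intro sum.cong) (auto simp: power_int_minus power_diff field_simps)
    finally show ?thesis .
  qed
  ultimately show thesis using that c by blast
qed

text \<open>The same argument with shift 1. The constant \<open>c\<close> now comes from comparing
  values at 0, where only \<open>m = n\<close> contributes.\<close>

lemma combination_reciprocal:
  assumes "kernel (\<lambda>z m. z powi (- int m) * \<xi>s m z) a"
  obtains c where "combination \<phi>s a = Polynomial.smult c (\<Phi>s n)"
    "c * \<kappa>h = a n * \<kappa> n"
    "\<And>z. z \<notin> sphere 0 1 \<Longrightarrow> poly P z * (c * assoc_star_fun what \<Psi> n z) =
      z ^ n * (\<Sum>m=n-L..n. z powi (- int m) * \<xi>s m z * a m)"
proof -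
  have \<xi>s: "z powi (- int m) * \<xi>s m z = - 2 * z * E (\<lambda>\<zeta>. poly (\<phi>s m) \<zeta> * \<zeta> powi (1 - 1 - int m) / (\<zeta> - z))"
    if "z \<noteq> 0" "z \<notin> sphere 0 1" for z m
    unfolding orig.assoc_star_fun_eq[OF that(2)] using that by (simp add: power_int_minus)
  have poles: "(\<Sum>m=n-L..n. E (\<lambda>\<zeta>. poly (\<phi>s m) \<zeta> * \<zeta> powi (1 - 1 - int m) / (\<zeta> - \<beta> j)) * a m) = 0"
    if "j \<in> {1..L}" for j
  proof -
    let ?S = "\<Sum>m=n-L..n. E (\<lambda>\<zeta>. poly (\<phi>s m) \<zeta> * \<zeta> powi (1 - 1 - int m) / (\<zeta> - \<beta> j)) * a m"
    have "(- 2 * \<beta> j) * ?S = (\<Sum>m=n-L..n. \<beta> j powi (- int m) * \<xi>s m (\<beta> j) * a m)"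
      unfolding \<xi>s[OF \<beta>_nonzero[OF that] off_circle[OF that]] sum_distrib_left by (simp only: mult.assoc)
    also have "\<dots> = 0" using assms that by blast
    finally show ?thesis using \<beta>_nonzero[OF that] by simp
  qed
  have orth: "E (\<lambda>z. poly (\<phi>s m) z * z powi (- k)) = 0" if "1 \<le> k" "k < int m + 1" for m k
    using orig.E_reciprocal_powi[of k m] that by simp
  have comb_orth: "E (\<lambda>z. poly (combination \<phi>s a) z * z powi (- k) / poly P z) = 0"
    if "1 \<le> k" "k < int n + 1" for k
    by (rule combination_orth[OF orth poles that])
  have comb_kernel:
    "poly P z * E (\<lambda>\<zeta>. poly (combination \<phi>s a) \<zeta> * \<zeta> powi (1 - 1 - int n) / (\<zeta> - z) / poly P \<zeta>) =
      (\<Sum>m=n-L..n. E (\<lambda>\<zeta>. poly (\<phi>s m) \<zeta> * \<zeta> powi (1 - 1 - int m) / (\<zeta> - z)) * a m)"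
    if "z \<notin> sphere 0 1" for z
    by (rule combination_kernel[OF orth poles that])
  define c where "c = coeff (combination \<phi>s a) 0 / \<kappa>h"
  have c: "combination \<phi>s a = Polynomial.smult c (\<Phi>s n)"
    unfolding c_def
  proof (rule hat.unique_reciprocal)
    show "hat.E (\<lambda>z. poly (combination \<phi>s a) z * z powi (- k)) = 0" if "k \<in> {1..int n}" for k
      unfolding hat_E using that by (intro comb_orth) auto
  qed (simp add: degree_combination orig.degree_reciprocal)
  moreover have "c * \<kappa>h = a n * \<kappa> n"
    by (simp add: c_def coeff_combination_0)
  moreover have "poly P z * (c * assoc_star_fun what \<Psi> n z) =
      z ^ n * (\<Sum>m=n-L..n. z powi (- int m) * \<xi>s m z * a m)"
    if z: "z \<notin> sphere 0 1" for z
  proof (cases "z = 0")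
    case True
    \<comment> \<open>Both sides carry the factor \<open>0 ^ n\<close> with
      \<open>n > 0\<close>.\<close>
    then show ?thesis using n_pos unfolding assoc_star_fun_def by (simp add: zero_power)
  next
    case False
    have "c * assoc_star_fun what \<Psi> n z =
        - 2 * z ^ Suc n * (c * hat.E (\<lambda>\<zeta>. poly (\<Phi>s n) \<zeta> * \<zeta> powi (- int n) / (\<zeta> - z)))"
      unfolding hat.assoc_star_fun_eq[OF z] by simp
    also have "c * hat.E (\<lambda>\<zeta>. poly (\<Phi>s n) \<zeta> * \<zeta> powi (- int n) / (\<zeta> - z)) =
        E (\<lambda>\<zeta>. poly (combination \<phi>s a) \<zeta> * \<zeta> powi (1 - 1 - int n) / (\<zeta> - z) / poly P \<zeta>)"
      unfolding hat_E c weighted_int_cmult[symmetric] by (simp add: mult.assoc)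
    finally have "poly P z * (c * assoc_star_fun what \<Psi> n z) = - 2 * z ^ Suc n *
        (\<Sum>m=n-L..n. E (\<lambda>\<zeta>. poly (\<phi>s m) \<zeta> * \<zeta> powi (1 - 1 - int m) / (\<zeta> - z)) * a m)"
      unfolding comb_kernel[OF z, symmetric] by simp
    also have "\<dots> = z ^ n * (\<Sum>m=n-L..n. z powi (- int m) * \<xi>s m z * a m)"
      unfolding \<xi>s[OF False z] by (simp add: sum_distrib_left mult_ac sum_negf)
    finally show ?thesis .
  qed
  ultimately show thesis using that by blast
qed

text \<open>Each \<open>v'_row\<close> is the corresponding \<open>v_row\<close> divided by
  \<open>\<beta> j\<close>, while the first row keeps the scale 1.\<close>

lemma v'_row_det:
  "row_det (c_row n L f # map (\<lambda>j. v'_row n L a (\<beta> j)) [1..<Suc L]) =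
    row_det (c_row n L f # map (\<lambda>j. v_row n L a (\<beta> j)) [1..<Suc L]) / (\<Prod>j=1..L. \<beta> j)"
proof -
  define s where "s i = (if i = 0 then 1 else inverse (\<beta> i))" for i
  have "row_det (c_row n L f # map (\<lambda>j. v'_row n L a (\<beta> j)) [1..<Suc L]) =
      (\<Prod>i<Suc L. s i) * row_det (c_row n L f # map (\<lambda>j. v_row n L a (\<beta> j)) [1..<Suc L])"
  proof (subst row_det_scale_rows[where s = s])
    fix i assume "i < length (c_row n L f # map (\<lambda>j. v'_row n L a (\<beta> j)) [1..<Suc L])"
    then have i: "i \<le> L" by simp
    show "length ((c_row n L f # map (\<lambda>j. v_row n L a (\<beta> j)) [1..<Suc L]) ! i) =
        length (c_row n L f # map (\<lambda>j. v'_row n L a (\<beta> j)) [1..<Suc L])"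
      using i L_le by (cases i) (auto simp: c_row_def v_row_def)
    show "(c_row n L f # map (\<lambda>j. v'_row n L a (\<beta> j)) [1..<Suc L]) ! i =
        map ((*) (s i)) ((c_row n L f # map (\<lambda>j. v_row n L a (\<beta> j)) [1..<Suc L]) ! i)"
      using i \<beta>_nonzero[of i]
      by (cases i) (auto simp: s_def c_row_def v_row_def v'_row_def power_int_diff field_simps)
  qed simp_all
  also have "(\<Prod>i<Suc L. s i) = (\<Prod>j=1..L. inverse (\<beta> j))"
    unfolding prod.lessThan_Suc_shift by (simp add: s_def prod.atLeast1_atMost_eq)
  finally show ?thesis
    using prod_dividef[of "\<lambda>_. 1" \<beta> "{1..L}"] by (simp add: inverse_eq_divide)
qed

lemma \<phi>_at_0_nonzero [simp]: "coeff (\<phi> m) 0 \<noteq> 0"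
  using \<phi>_0_nonzero[of m] orig.lead_nonzero[of 0] by (cases m) auto

lemma sign_square: "(-1) ^ L * ((-1) ^ L * x) = (x::complex)"
  by (simp flip: power_mult_distrib mult.assoc)

abbreviation \<xi>_det where
  "\<xi>_det r \<equiv> row_det (r # map (\<lambda>j. v_row n L \<xi> (\<beta> j)) [1..<Suc L])"
abbreviation \<xi>_minor where
  "\<xi>_minor \<equiv> row_det (map (\<lambda>j. u_row n L \<xi> (\<beta> j)) [1..<Suc L])"
abbreviation \<xi>s_det where
  "\<xi>s_det r \<equiv> row_det (r # map (\<lambda>j. v_row n L \<xi>s (\<beta> j)) [1..<Suc L])"
abbreviation \<xi>s_minor where
  "\<xi>s_minor \<equiv> row_det (map (\<lambda>j. u_row n L \<xi>s (\<beta> j)) [1..<Suc L])"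

text \<open>All these determinants have the same cofactors along the first row, so they are
  functionals of one combination, \<open>c\<close> times \<open>\<Phi> n\<close>: its value, its
  transform, its top coefficient, its moment of index \<open>n\<close> and its constant
  coefficient.\<close>

lemma \<phi>_determinants:
  obtains c where "c \<noteq> 0"
    "\<And>z. \<xi>_det (z_row n L (\<lambda>m. poly (\<phi> m)) z) = c * poly (\<Phi> n) z"
    "\<And>z. z \<notin> sphere 0 1 \<Longrightarrow> \<xi>_det (z_row n L \<xi> z) = c * (poly P z * assoc_fun what \<Phi> n z)"
    "\<xi>_det (c_row n L \<kappa>) = c * \<kappa>h"
    "\<xi>_det (c_row n L (\<lambda>m. 1 / \<kappa> m)) = c * poly P 0 / \<kappa>h"
    "\<xi>_minor = (-1) ^ L * c * coeff (\<Phi> n) 0 / coeff (\<phi> n) 0"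
proof -
  obtain cof where cof:
    "\<And>f. \<xi>_det (map f [n - L..<Suc n]) = (\<Sum>m=n-L..n. f m * cof m)"
    "kernel (\<lambda>z m. z powi (- int m) * \<xi> m z) cof"
    "cof n = (-1) ^ L * \<xi>_minor"
    "\<And>f. \<xi>_det (map f [n - L..<Suc n]) = 0 \<Longrightarrow>
      \<exists>a. (\<exists>m\<in>{n-L..n}. a m \<noteq> 0) \<and> (\<Sum>m=n-L..n. f m * a m) = 0 \<and>
        kernel (\<lambda>z m. z powi (- int m) * \<xi> m z) a"
    unfolding v_row_def u_row_def
    by (rule bordered_row_det[OF L_le, of "\<lambda>j m. \<beta> j powi (- int m) * \<xi> m (\<beta> j)"]) blast
  obtain c where c: "combination \<phi> cof = Polynomial.smult c (\<Phi> n)"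
    "c * poly P 0 = \<kappa>h * (\<Sum>m=n-L..n. 1 / \<kappa> m * cof m)"
    "\<And>z. z \<notin> sphere 0 1 \<Longrightarrow> poly P z * (c * assoc_fun what \<Phi> n z) = (\<Sum>m=n-L..n. z ^ (n - m) * \<xi> m z * cof m)"
    using combination_\<phi>[OF cof(2)] by blast
  \<comment> \<open>This first row is the one that determines \<open>c\<close>. A null vector would
    give a combination that is zero times \<open>\<Phi> n\<close>, against the independence in
    \<open>combination_eq_0\<close>.\<close>
  have "\<xi>_det (map (\<lambda>m. 1 / \<kappa> m) [n - L..<Suc n]) \<noteq> 0"
  proof
    assume "\<xi>_det (map (\<lambda>m. 1 / \<kappa> m) [n - L..<Suc n]) = 0"
    from cof(4)[OF this] obtain a where a: "\<exists>m\<in>{n-L..n}. a m \<noteq> 0"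
      "(\<Sum>m=n-L..n. 1 / \<kappa> m * a m) = 0" "kernel (\<lambda>z m. z powi (- int m) * \<xi> m z) a"
      by blast
    obtain c' where "combination \<phi> a = Polynomial.smult c' (\<Phi> n)"
      "c' * poly P 0 = \<kappa>h * (\<Sum>m=n-L..n. 1 / \<kappa> m * a m)"
      using combination_\<phi>[OF a(3)] by blast
    then have "combination \<phi> a = 0" using a(2) P_0_nonzero by simp
    then show False using combination_eq_0[of \<phi> a] a(1) by auto
  qed
  then have "(\<Sum>m=n-L..n. 1 / \<kappa> m * cof m) \<noteq> 0" unfolding cof(1) .
  then have "c \<noteq> 0" using c(2) hat.lead_nonzero[of n] by auto
  moreover have "\<xi>_det (z_row n L (\<lambda>m. poly (\<phi> m)) z) = c * poly (\<Phi> n) z" for z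
    unfolding z_row_def cof(1) using arg_cong[OF c(1), of "\<lambda>p. poly p z"]
    by (simp add: poly_combination)
  moreover have "\<xi>_det (z_row n L \<xi> z) = c * (poly P z * assoc_fun what \<Phi> n z)"
    if "z \<notin> sphere 0 1" for z
    unfolding z_row_def cof(1) using c(3)[OF that] by (simp add: mult_ac)
  moreover have "\<xi>_det (c_row n L \<kappa>) = c * \<kappa>h"
    unfolding c_row_def cof(1) using arg_cong[OF c(1), of "\<lambda>p. coeff p n"]
    by (simp add: coeff_combination_top)
  moreover have "\<xi>_det (c_row n L (\<lambda>m. 1 / \<kappa> m)) = c * poly P 0 / \<kappa>h"
    unfolding c_row_def cof(1) c(2) using hat.lead_nonzero[of n] by simp
  moreover have "cof n * coeff (\<phi> n) 0 = c * coeff (\<Phi> n) 0"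
    using arg_cong[OF c(1), of "\<lambda>p. coeff p 0"] by (simp add: coeff_combination_0)
  then have "cof n = c * coeff (\<Phi> n) 0 / coeff (\<phi> n) 0"
    by (simp add: eq_divide_eq)
  then have "\<xi>_minor = (-1) ^ L * c * coeff (\<Phi> n) 0 / coeff (\<phi> n) 0"
    using sign_square[of \<xi>_minor] unfolding cof(3) by (simp add: mult.assoc)
  ultimately show thesis using that by blast
qed

text \<open>The starred counterpart. The leading coefficient of the combination now yields the
  values of the companions at 0, and its constant coefficient yields the minor.\<close>

lemma reciprocal_determinants:
  obtains c where "c \<noteq> 0"
    "\<And>z. \<xi>s_det (z_row n L (\<lambda>m. poly (\<phi>s m)) z) = c * poly (\<Phi>s n) z"
    "\<And>z. z \<notin> sphere 0 1 \<Longrightarrow>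
      z ^ n * \<xi>s_det (v_row n L \<xi>s z) = c * (poly P z * assoc_star_fun what \<Psi> n z)"
    "\<xi>s_det (c_row n L (\<lambda>m. poly (\<psi> m) 0)) = c * poly (\<Psi> n) 0"
    "\<xi>s_minor = (-1) ^ L * c * \<kappa>h / \<kappa> n"
proof -
  obtain cof where cof:
    "\<And>f. \<xi>s_det (map f [n - L..<Suc n]) = (\<Sum>m=n-L..n. f m * cof m)"
    "kernel (\<lambda>z m. z powi (- int m) * \<xi>s m z) cof"
    "cof n = (-1) ^ L * \<xi>s_minor"
    "\<And>f. \<xi>s_det (map f [n - L..<Suc n]) = 0 \<Longrightarrow>
      \<exists>a. (\<exists>m\<in>{n-L..n}. a m \<noteq> 0) \<and> (\<Sum>m=n-L..n. f m * a m) = 0 \<and>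
        kernel (\<lambda>z m. z powi (- int m) * \<xi>s m z) a"
    unfolding v_row_def u_row_def
    by (rule bordered_row_det[OF L_le, of "\<lambda>j m. \<beta> j powi (- int m) * \<xi>s m (\<beta> j)"]) blast
  obtain c where c: "combination \<phi>s cof = Polynomial.smult c (\<Phi>s n)"
    "c * \<kappa>h = cof n * \<kappa> n"
    "\<And>z. z \<notin> sphere 0 1 \<Longrightarrow> poly P z * (c * assoc_star_fun what \<Psi> n z) =
      z ^ n * (\<Sum>m=n-L..n. z powi (- int m) * \<xi>s m z * cof m)"
    using combination_reciprocal[OF cof(2)] by blast
  \<comment> \<open>The last unit row singles out \<open>cof n\<close>, which determines
    \<open>c\<close> through \<open>c * \<kappa>h = cof n * \<kappa> n\<close>; it takes the part of
    the row \<open>1 / \<kappa> m\<close> above.\<close>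
  let ?e = "\<lambda>m. if m = n then 1 else 0 :: complex"
  have e_sum: "(\<Sum>m=n-L..n. ?e m * a m) = a n" for a
  proof -
    have "(\<Sum>m=n-L..n. ?e m * a m) = (\<Sum>m=n-L..n. if m = n then a n else 0)"
      by (intro sum.cong) auto
    then show ?thesis by simp
  qed
  have "\<xi>s_det (map ?e [n - L..<Suc n]) \<noteq> 0"
  proof
    assume "\<xi>s_det (map ?e [n - L..<Suc n]) = 0"
    from cof(4)[OF this] obtain a where a: "\<exists>m\<in>{n-L..n}. a m \<noteq> 0"
      "(\<Sum>m=n-L..n. ?e m * a m) = 0" "kernel (\<lambda>z m. z powi (- int m) * \<xi>s m z) a"
      by blast
    obtain c' where "combination \<phi>s a = Polynomial.smult c' (\<Phi>s n)" "c' * \<kappa>h = a n * \<kappa> n"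
      using combination_reciprocal[OF a(3)] by blast
    then have "combination \<phi>s a = 0" using a(2) hat.lead_nonzero[of n] unfolding e_sum by simp
    then show False using combination_eq_0[of \<phi>s a] a(1) by auto
  qed
  then have "cof n \<noteq> 0" unfolding cof(1) e_sum .
  then have "c \<noteq> 0" using c(2) orig.lead_nonzero[of n] by auto
  moreover have "\<xi>s_det (z_row n L (\<lambda>m. poly (\<phi>s m)) z) = c * poly (\<Phi>s n) z" for z
    unfolding z_row_def cof(1) using arg_cong[OF c(1), of "\<lambda>p. poly p z"]
    by (simp add: poly_combination)
  moreover have "z ^ n * \<xi>s_det (v_row n L \<xi>s z) = c * (poly P z * assoc_star_fun what \<Psi> n z)"
    if "z \<notin> sphere 0 1" for z
    unfolding v_row_def[of n L \<xi>s z] cof(1) using c(3)[OF that] by (simp add: mult_ac)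
  moreover have "\<xi>s_det (c_row n L (\<lambda>m. poly (\<psi> m) 0)) = c * poly (\<Psi> n) 0"
    unfolding c_row_def cof(1) using arg_cong[OF c(1), of "\<lambda>p. coeff p n"]
    by (simp add: coeff_combination_top reciprocal_def coeff_reflect_poly poly_0_coeff_0)
  moreover have "cof n = c * \<kappa>h / \<kappa> n"
    using c(2) by (simp add: eq_divide_eq)
  then have "\<xi>s_minor = (-1) ^ L * c * \<kappa>h / \<kappa> n"
    using sign_square[of \<xi>s_minor] unfolding cof(3) by (simp add: mult.assoc)
  ultimately show thesis using that by blast
qed

end

theorem proposition3p2:
  fixes w what :: "complex \<Rightarrow> complex"
    and \<phi> \<phi>b \<Phi> \<Phi>b :: "nat \<Rightarrow> complex poly"
    and \<beta> :: "nat \<Rightarrow> complex"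
    and L n :: nat
    and \<kappa> \<kappa>hat :: "nat \<Rightarrow> complex"
    and \<xi> \<xi>s \<Xi> \<Xi>s :: "nat \<Rightarrow> complex \<Rightarrow> complex"
  assumes L: "L \<ge> 1" and n: "n \<ge> L"
    and beta_distinct: "inj_on \<beta> {1..L}"
    and beta_off: "\<forall>j\<in>{1..L}. \<beta> j \<noteq> 0 \<and> \<beta> j \<notin> sphere 0 1"
    and weight: "circle_weight w"
    and what: "what = (\<lambda>z. w z / (\<Prod>j=1..L. z - \<beta> j))"
    and system: "biorthogonal_system w \<phi> \<phi>b"
    and system_hat: "biorthogonal_system what \<Phi> \<Phi>b"
    and generic: "\<forall>m\<ge>1. r_coeff \<phi> m * r_coeff \<phi>b m \<noteq> 0 \<and> r_coeff \<phi> m * r_coeff \<phi>b m \<noteq> 1"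
    and generic_hat: "\<forall>m\<ge>1. r_coeff \<Phi> m * r_coeff \<Phi>b m \<noteq> 0 \<and> r_coeff \<Phi> m * r_coeff \<Phi>b m \<noteq> 1"
    and kappa: "\<kappa> = (\<lambda>m. lead_coeff (\<phi> m))"
    and kappa_hat: "\<kappa>hat = (\<lambda>m. lead_coeff (\<Phi> m))"
    and xi: "\<xi> = assoc_fun w \<phi>" and xi_star: "\<xi>s = assoc_star_fun w \<phi>b"
    and Xi: "\<Xi> = assoc_fun what \<Phi>" and Xi_star: "\<Xi>s = assoc_star_fun what \<Phi>b"
  shows
    "(\<forall>z. poly (\<Phi> n) z =
        (-1) ^ L / \<kappa>hat n *
        (row_det (z_row n L (\<lambda>m. poly (\<phi> m)) z # map (\<lambda>j. v_row n L \<xi> (\<beta> j)) [1..<Suc L]) /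
         row_det (c_row n L (\<lambda>m. 1 / \<kappa> m) # map (\<lambda>j. v'_row n L \<xi> (\<beta> j)) [1..<Suc L]))) \<and>
     (\<forall>z. poly (reciprocal \<Phi>b n) z =
        (-1) ^ L * (\<kappa>hat n / \<kappa> n) *
        (row_det (z_row n L (\<lambda>m. poly (reciprocal \<phi>b m)) z # map (\<lambda>j. v_row n L \<xi>s (\<beta> j)) [1..<Suc L]) /
         row_det (map (\<lambda>j. u_row n L \<xi>s (\<beta> j)) [1..<Suc L]))) \<and>
     (\<exists>C. \<forall>z. z \<notin> sphere 0 1 \<longrightarrow>
        (\<Prod>j=1..L. z - \<beta> j) * \<Xi> n z =
        C * (row_det (z_row n L \<xi> z # map (\<lambda>j. v_row n L \<xi> (\<beta> j)) [1..<Suc L]) /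
             row_det (map (\<lambda>j. u_row n L \<xi> (\<beta> j)) [1..<Suc L]))) \<and>
     (\<forall>z. z \<notin> sphere 0 1 \<longrightarrow>
        (\<Prod>j=1..L. z - \<beta> j) * \<Xi>s n z =
        (-1) ^ L * (\<kappa>hat n / \<kappa> n) * z ^ n *
        (row_det (v_row n L \<xi>s z # map (\<lambda>j. v_row n L \<xi>s (\<beta> j)) [1..<Suc L]) /
         row_det (map (\<lambda>j. u_row n L \<xi>s (\<beta> j)) [1..<Suc L]))) \<and>
     (\<kappa>hat n)\<^sup>2 =
        (-1) ^ L *
        (row_det (c_row n L \<kappa> # map (\<lambda>j. v_row n L \<xi> (\<beta> j)) [1..<Suc L]) /
         row_det (c_row n L (\<lambda>m. 1 / \<kappa> m) # map (\<lambda>j. v'_row n L \<xi> (\<beta> j)) [1..<Suc L])) \<and>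
     r_coeff \<Phi> n =
        (-1) ^ L * poly (\<phi> n) 0 *
        (row_det (map (\<lambda>j. u_row n L \<xi> (\<beta> j)) [1..<Suc L]) /
         row_det (c_row n L \<kappa> # map (\<lambda>j. v_row n L \<xi> (\<beta> j)) [1..<Suc L])) \<and>
     r_coeff \<Phi>b n =
        (-1) ^ L / \<kappa> n *
        (row_det (c_row n L (\<lambda>m. poly (\<phi>b m) 0) # map (\<lambda>j. v_row n L \<xi>s (\<beta> j)) [1..<Suc L]) /
         row_det (map (\<lambda>j. u_row n L \<xi>s (\<beta> j)) [1..<Suc L]))"
proof -
  have Q: "continuous_on (sphere 0 1) (\<lambda>z. 1 / (\<Prod>j=1..L. z - \<beta> j))"
    using beta_off by (intro continuous_intros) auto
  have weight_hat: "circle_weight what"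
    using circle_weight_mult[OF weight Q] by (simp add: what)
  interpret S: modified_system w \<beta> L n \<phi> \<phi>b \<Phi> \<Phi>b
  proof
    show "coeff (\<phi> m) 0 \<noteq> 0" if "m \<ge> 1" for m
      using generic that by (auto simp: r_coeff_def poly_0_coeff_0)
    show "coeff (\<Phi> n) 0 \<noteq> 0"
      using generic_hat L n by (auto simp: r_coeff_def poly_0_coeff_0)
  qed (use L n beta_distinct beta_off weight system system_hat weight_hat what in auto)
  \<comment> \<open>The factors \<open>c\<close> and \<open>d\<close> stay implicit: each formula
    involves a quotient of two determinants sharing the same factor.\<close>
  obtain c where "c \<noteq> 0" and c:
    "\<And>z. S.\<xi>_det (z_row n L (\<lambda>m. poly (\<phi> m)) z) = c * poly (\<Phi> n) z"
    "\<And>z. z \<notin> sphere 0 1 \<Longrightarrow> S.\<xi>_det (z_row n L S.\<xi> z) = c * (poly S.P z * assoc_fun S.what \<Phi> n z)"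
    "S.\<xi>_det (c_row n L S.\<kappa>) = c * S.\<kappa>h"
    "S.\<xi>_det (c_row n L (\<lambda>m. 1 / S.\<kappa> m)) = c * poly S.P 0 / S.\<kappa>h"
    "S.\<xi>_minor = (-1) ^ L * c * coeff (\<Phi> n) 0 / coeff (\<phi> n) 0"
    by (rule S.\<phi>_determinants) blast
  obtain d where "d \<noteq> 0" and d:
    "\<And>z. S.\<xi>s_det (z_row n L (\<lambda>m. poly (S.\<phi>s m)) z) = d * poly (S.\<Phi>s n) z"
    "\<And>z. z \<notin> sphere 0 1 \<Longrightarrow>
      z ^ n * S.\<xi>s_det (v_row n L S.\<xi>s z) = d * (poly S.P z * assoc_star_fun S.what \<Phi>b n z)"
    "S.\<xi>s_det (c_row n L (\<lambda>m. poly (\<phi>b m) 0)) = d * poly (\<Phi>b n) 0"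
    "S.\<xi>s_minor = (-1) ^ L * d * S.\<kappa>h / S.\<kappa> n"
    by (rule S.reciprocal_determinants) blast
  define D where "D r = row_det (r # map (\<lambda>j. v_row n L \<xi> (\<beta> j)) [1..<Suc L])" for r
  define Ds where "Ds r = row_det (r # map (\<lambda>j. v_row n L \<xi>s (\<beta> j)) [1..<Suc L])" for r
  define U where "U = row_det (map (\<lambda>j. u_row n L \<xi> (\<beta> j)) [1..<Suc L])"
  define Us where "Us = row_det (map (\<lambda>j. u_row n L \<xi>s (\<beta> j)) [1..<Suc L])"
  define D' where "D' = row_det (c_row n L (\<lambda>m. 1 / \<kappa> m) # map (\<lambda>j. v'_row n L \<xi> (\<beta> j)) [1..<Suc L])"
  have lead: "\<kappa> m = coeff (\<phi> m) m" "\<kappa>hat m = coeff (\<Phi> m) m" for m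
    by (simp_all add: kappa kappa_hat)
  have nz: "\<kappa>hat n \<noteq> 0" "\<kappa> n \<noteq> 0" "(\<Prod>j=1..L. \<beta> j) \<noteq> 0" "coeff (\<phi> n) 0 \<noteq> 0" "coeff (\<Phi> n) 0 \<noteq> 0"
    using beta_off S.\<Phi>_0_nonzero S.hat.lead_nonzero[of n] by (auto simp: lead)
  have D_phi: "D (z_row n L (\<lambda>m. poly (\<phi> m)) z) = c * poly (\<Phi> n) z" for z
    unfolding D_def xi by (rule c(1))
  have D_xi: "D (z_row n L \<xi> z) = c * ((\<Prod>j=1..L. z - \<beta> j) * \<Xi> n z)" if "z \<notin> sphere 0 1" for z
    unfolding D_def xi Xi what by (rule c(2)[OF that, unfolded S.poly_P])
  have D_kappa: "D (c_row n L \<kappa>) = c * \<kappa>hat n"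
    using c(3) unfolding D_def xi lead[abs_def] .
  \<comment> \<open>The product of the \<open>\<beta> j\<close> in the value of \<open>P\<close> at
    0 cancels the one from the rows \<open>v'_row\<close>, leaving only the sign.\<close>
  have D': "D' = (-1) ^ L * c / \<kappa>hat n"
    using c(4) nz unfolding D'_def xi lead[abs_def] S.v'_row_det S.P_0 by simp
  have U: "U = (-1) ^ L * c * coeff (\<Phi> n) 0 / coeff (\<phi> n) 0"
    unfolding U_def xi by (rule c(5))
  have Ds_phi: "Ds (z_row n L (\<lambda>m. poly (reciprocal \<phi>b m)) z) = d * poly (reciprocal \<Phi>b n) z" for z
    unfolding Ds_def xi_star by (rule d(1))
  have Ds_xi: "z ^ n * Ds (v_row n L \<xi>s z) = d * ((\<Prod>j=1..L. z - \<beta> j) * \<Xi>s n z)"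
    if "z \<notin> sphere 0 1" for z
    unfolding Ds_def xi_star Xi_star what by (rule d(2)[OF that, unfolded S.poly_P])
  have Ds_0: "Ds (c_row n L (\<lambda>m. poly (\<phi>b m) 0)) = d * poly (\<Phi>b n) 0"
    unfolding Ds_def xi_star by (rule d(3))
  have Us: "Us = (-1) ^ L * d * \<kappa>hat n / \<kappa> n"
    unfolding Us_def xi_star lead by (rule d(4))
  \<comment> \<open>The witness \<open>U / c\<close> equals \<open>(-1) ^ L\<close> times the
    quotient of the values of \<open>\<Phi> n\<close> and \<open>\<phi> n\<close> at 0, and so does
    not depend on \<open>z\<close>.\<close>
  have "\<exists>C. \<forall>z. z \<notin> sphere 0 1 \<longrightarrow> (\<Prod>j=1..L. z - \<beta> j) * \<Xi> n z = C * (D (z_row n L \<xi> z) / U)"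
    using nz \<open>c \<noteq> 0\<close> by (intro exI[of _ "U / c"]) (simp add: D_xi U)
  moreover have "poly (\<Phi> n) z = (-1) ^ L / \<kappa>hat n * (D (z_row n L (\<lambda>m. poly (\<phi> m)) z) / D')" for z
    using nz \<open>c \<noteq> 0\<close> by (simp add: D_phi D')
  moreover have "poly (reciprocal \<Phi>b n) z = (-1) ^ L * (\<kappa>hat n / \<kappa> n) *
      (Ds (z_row n L (\<lambda>m. poly (reciprocal \<phi>b m)) z) / Us)" for z
    using nz \<open>d \<noteq> 0\<close> by (simp add: Ds_phi Us)
  moreover have "(\<Prod>j=1..L. z - \<beta> j) * \<Xi>s n z = (-1) ^ L * (\<kappa>hat n / \<kappa> n) * z ^ n *
      (Ds (v_row n L \<xi>s z) / Us)" if "z \<notin> sphere 0 1" for z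
  proof -
    have "(-1) ^ L * (\<kappa>hat n / \<kappa> n) * z ^ n * (Ds (v_row n L \<xi>s z) / Us) =
        (-1) ^ L * (\<kappa>hat n / \<kappa> n) * (z ^ n * Ds (v_row n L \<xi>s z)) / Us" by simp
    then show ?thesis
      unfolding Ds_xi[OF that] using nz \<open>d \<noteq> 0\<close> by (simp add: Us)
  qed
  moreover have "(\<kappa>hat n)\<^sup>2 = (-1) ^ L * (D (c_row n L \<kappa>) / D')"
    using nz \<open>c \<noteq> 0\<close> by (simp add: D_kappa D' power2_eq_square)
  moreover have "r_coeff \<Phi> n = (-1) ^ L * poly (\<phi> n) 0 * (U / D (c_row n L \<kappa>))"
    using nz \<open>c \<noteq> 0\<close> by (simp add: D_kappa U r_coeff_def poly_0_coeff_0 lead)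
  moreover have "r_coeff \<Phi>b n = (-1) ^ L / \<kappa> n * (Ds (c_row n L (\<lambda>m. poly (\<phi>b m) 0)) / Us)"
    using nz \<open>d \<noteq> 0\<close> by (simp add: Ds_0 Us r_coeff_def S.hat.lead_eq lead)
  ultimately show ?thesis
    unfolding D_def Ds_def U_def Us_def D'_def by blast
qed

end
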